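(* Let $n\ge1$ and let $\Lambda_0\in\mathbb G(n-1,n+2)$ be such that $\Lambda_0\cap\Sigma\subset\mathbb P^{n+2}$ is a zero-dimensional scheme whose support contains $y\in\Sigma$ with multiplicity $r\ge1$. Let $Z_y$ be as in the context (with $d=3$). Then $$O^2_{\Lambda_0}(Z_y)\cap\mathbb G(n-1,n+2)\subseteq\mathcal A\cup\mathcal B\cup\mathcal C,$$ where $\mathcal A=\{\Lambda\in\mathbb G(n-1,n+2):\ \Lambda\subseteq\langle\Lambda_0,O^{r+1}_y(\Sigma)\rangle,\ \dim(\Lambda\cap O^{r-1}_y(\Sigma))\ge r-2\}$, $\mathcal B=\{\Lambda\in\mathbb G(n-1,n+2):\ O^{r-2}_y(\Sigma)\subseteq\Lambda,\ \dim(\Lambda\cap O^r_y(\Sigma))\ge r-1,\ \dim(\Lambda\cap\langle\Lambda_0,O^r_y(\Sigma)\rangle)\ge n-2\}$, $\mathcal C=\{\Lambda\in\mathbb G(n-1,n+2):\ O^{r-1}_y(\Sigma)\subseteq\Lambda,\ \dim(\Lambda\cap\Lambda_0)\ge n-3\}$.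
   Context: $K$ is an algebraically closed field of characteristic $0$. Let $z_0,\dots,z_{n+2}$ be coordinates on $\mathbb P^{n+2}$ and $\Sigma=\{[t_0^{n+2}:t_0^{n+1}t_1:\dots:t_1^{n+2}]\}$ the standard rational normal curve. $\mathbb G(n-1,n+2)$ is the Grassmannian of $(n-1)$-spaces of $\mathbb P^{n+2}$ embedded in $\mathbb P^{\binom{n+3}{3}-1}$ by (dual) Plücker coordinates: for $\Lambda$ cut out by independent equations $\sum_j u_{i,j}z_j=0$, $i=1,2,3$, they are the $3\times3$ minors $\det(u_{a,i_b})$. For $y\in\Sigma$ and $k\ge0$, $O^k_y(\Sigma)$ is the $k$-th osculating space of $\Sigma$ at $y$ (span of the length-$(k+1)$ subscheme of $\Sigma$ at $y$), empty for $k<0$; $\langle\cdot,\cdot\rangle$ is linear span; $\dim\emptyset=-1$. Let $I=\{(\Lambda,y')\in\mathbb G(n-1,n+2)\times\Sigma:\ \mathrm{length}_{y'}(\Lambda\cap\Sigma)\ge r\}$ with projection $\pi_1$ to the Grassmannian; $Z_y$ is the image under $\pi_1$ of a neighbourhood of $(\Lambda_0,y)$ in $I$ (a germ of subvariety at $\Lambda_0$), and $O^2_{\Lambda_0}(Z_y)$ is its second osculating space at $\Lambda_0$ in the Plücker space. *)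

theory Defs
  imports "HOL-Library.Function_Algebras"
          "HOL-Computational_Algebra.Polynomial"
          "HOL-Computational_Algebra.Formal_Power_Series"
begin

definition fscale :: "'a::field \<Rightarrow> ('i \<Rightarrow> 'a) \<Rightarrow> ('i \<Rightarrow> 'a)" where
  "fscale c v = (\<lambda>x. c * v x)"

abbreviation lspan :: "('i \<Rightarrow> 'a::field) set \<Rightarrow> ('i \<Rightarrow> 'a) set" where
  "lspan S \<equiv> module.span fscale S"

abbreviation lsubspace :: "('i \<Rightarrow> 'a::field) set \<Rightarrow> bool" where
  "lsubspace S \<equiv> module.subspace fscale S"

abbreviation ldim :: "('i \<Rightarrow> 'a::field) set \<Rightarrow> nat" where
  "ldim S \<equiv> vector_space.dim fscale S"

text \<open>Projective dimension of the projectivisation of a linear subspace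
  (dim of the empty projective space is -1).\<close>
definition pdim :: "('i \<Rightarrow> 'a::field) set \<Rightarrow> int" where
  "pdim V = int (ldim V) - 1"

definition vecs :: "nat \<Rightarrow> (nat \<Rightarrow> 'a::zero) set" where
  "vecs N = {v. \<forall>i\<ge>N. v i = 0}"

definition rnc :: "nat \<Rightarrow> 'a::comm_ring_1 \<Rightarrow> 'a \<Rightarrow> (nat \<Rightarrow> 'a)" where
  "rnc d a b = (\<lambda>j. if j \<le> d then a ^ (d - j) * b ^ j else 0)"

text \<open>k-th osculating space of Sigma at y = [a:b] (as a linear subspace of K^(d+1)):
  the span of the Taylor coefficients of order 0..k of all arcs
  s |-> rnc(a + s c, b + s e) through the point, i.e. the span of the
  length-(k+1) subscheme of Sigma at y.  Empty (= {0}) for k < 0.\<close>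
definition osc :: "nat \<Rightarrow> int \<Rightarrow> 'a::field \<Rightarrow> 'a \<Rightarrow> (nat \<Rightarrow> 'a) set" where
  "osc d k a b =
     (if k < 0 then {0}
      else lspan {(\<lambda>j. if j \<le> d then coeff ([:a, c:] ^ (d - j) * [:b, e:] ^ j) i else 0)
                  | c e i. i \<le> nat k})"

text \<open>The form w pulls back to the binary form sum_j w_j t0^(d-j) t1^j of degree d.
  It vanishes to order >= r at [a:b] (over any commutative ring, so that it can also
  be used over formal power series): for every direction (c,e), the polynomial
  s |-> f(a + s c, b + s e) has vanishing coefficients of s^0..s^(r-1).\<close>
definition vanishes_order :: "nat \<Rightarrow> (nat \<Rightarrow> 'b::comm_ring_1) \<Rightarrow> 'b \<Rightarrow> 'b \<Rightarrow> nat \<Rightarrow> bool" where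
  "vanishes_order d w a b r =
     (\<forall>c e. \<forall>m<r. coeff (\<Sum>j\<le>d. smult (w j) ([:a, c:] ^ (d - j) * [:b, e:] ^ j)) m = 0)"

definition eqs :: "nat \<Rightarrow> (nat \<Rightarrow> 'a::comm_ring_1) set \<Rightarrow> (nat \<Rightarrow> 'a) set" where
  "eqs N L = {w \<in> vecs N. \<forall>z\<in>L. (\<Sum>j<N. w j * z j) = 0}"

text \<open>length_y(Lambda \<inter> Sigma) >= r, for Lambda \<subseteq> P^(N-1), N = d+1, y = [a:b]:
  the scheme Lambda \<inter> Sigma \<subseteq> Sigma = P^1 is cut out by the pull-backs of the equations
  of Lambda; its local ring at y is a quotient of a DVR, so the length at y is the
  minimum of the vanishing orders at y of these pulled-back forms.\<close>
definition int_len_ge :: "nat \<Rightarrow> (nat \<Rightarrow> 'a::field) set \<Rightarrow> 'a \<Rightarrow> 'a \<Rightarrow> nat \<Rightarrow> bool" where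
  "int_len_ge N L a b r = (\<forall>w\<in>eqs N L. vanishes_order (N - 1) w a b r)"

text \<open>Lambda \<inter> Sigma is zero-dimensional: some equation of Lambda does not vanish
  identically on Sigma.\<close>
definition int_zero_dim :: "nat \<Rightarrow> (nat \<Rightarrow> 'a::field) set \<Rightarrow> bool" where
  "int_zero_dim N L = (\<exists>w\<in>eqs N L. \<exists>j<N. w j \<noteq> 0)"

text \<open>(n-1)-planes of P^(n+2) = n-dimensional linear subspaces of K^(n+3).\<close>
definition grass :: "nat \<Rightarrow> (nat \<Rightarrow> 'a::field) set set" where
  "grass n = {L. lsubspace L \<and> L \<subseteq> vecs (n + 3) \<and> ldim L = n}"

definition rows_indep :: "nat \<Rightarrow> (nat \<Rightarrow> nat \<Rightarrow> 'a::field) \<Rightarrow> bool" where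
  "rows_indep N u = (\<forall>c :: nat \<Rightarrow> 'a. (\<forall>j<N. (\<Sum>i<3. c i * u i j) = 0) \<longrightarrow> (\<forall>i<3. c i = 0))"

definition eq_rep :: "nat \<Rightarrow> (nat \<Rightarrow> 'a::field) set \<Rightarrow> (nat \<Rightarrow> nat \<Rightarrow> 'a) \<Rightarrow> bool" where
  "eq_rep N L u = (rows_indep N u \<and> (\<forall>i<3. \<forall>j\<ge>N. u i j = 0) \<and>
      L = {z \<in> vecs N. \<forall>i<3. (\<Sum>j<N. u i j * z j) = 0})"

definition det3 :: "(nat \<Rightarrow> nat \<Rightarrow> 'b::comm_ring_1) \<Rightarrow> 'b" where
  "det3 M = M 0 0 * M 1 1 * M 2 2 + M 0 1 * M 1 2 * M 2 0 + M 0 2 * M 1 0 * M 2 1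
          - M 0 2 * M 1 1 * M 2 0 - M 0 0 * M 1 2 * M 2 1 - M 0 1 * M 1 0 * M 2 2"

text \<open>Dual Pluecker coordinates, indexed by the 3-subsets {i1<i2<i3} of {0..N-1}:
  the minor det(u_{a,i_b}).  Works over any commutative ring (also formal power series).\<close>
definition pluecker :: "nat \<Rightarrow> (nat \<Rightarrow> nat \<Rightarrow> 'b::comm_ring_1) \<Rightarrow> (nat set \<Rightarrow> 'b)" where
  "pluecker N u = (\<lambda>S. if S \<subseteq> {..<N} \<and> card S = 3
       then det3 (\<lambda>a b. u a (sorted_list_of_set S ! b)) else 0)"

text \<open>Formal arcs (over K[[t]]) in I = {(Lambda,y') : length_{y'}(Lambda \<inter> Sigma) >= r}
  centred at (Lambda_0, y), y = [a:b]: Lambda(t) is given by three rows of equations u(t)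
  with u(0) a system of equations of Lambda_0, y(t) = [a(t):b(t)] with (a(0),b(0)) = (a,b).\<close>
definition arc_in_I :: "nat \<Rightarrow> nat \<Rightarrow> (nat \<Rightarrow> 'a::field) set \<Rightarrow> 'a \<Rightarrow> 'a \<Rightarrow>
    (nat \<Rightarrow> nat \<Rightarrow> 'a fps) \<Rightarrow> 'a fps \<Rightarrow> 'a fps \<Rightarrow> bool" where
  "arc_in_I n r L0 a b u ya yb =
     (eq_rep (n + 3) L0 (\<lambda>i j. fps_nth (u i j) 0) \<and> fps_nth ya 0 = a \<and> fps_nth yb 0 = b \<and>
      (\<forall>i<3. vanishes_order (n + 2) (u i) ya yb r))"

text \<open>Second osculating space of Z_y at Lambda_0 in Pluecker space: span of the 2-jets
  (Taylor coefficients of order 0,1,2) of the Pluecker images of all arcs of the germ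
  of I at (Lambda_0,y) (i.e. of all arcs of Z_y through Lambda_0 coming from I).\<close>
definition osc2_Z :: "nat \<Rightarrow> nat \<Rightarrow> (nat \<Rightarrow> 'a::field) set \<Rightarrow> 'a \<Rightarrow> 'a \<Rightarrow> (nat set \<Rightarrow> 'a) set" where
  "osc2_Z n r L0 a b = lspan {(\<lambda>S. fps_nth (pluecker (n + 3) u S) k) | u ya yb k.
        arc_in_I n r L0 a b u ya yb \<and> k \<le> 2}"

definition pl_in :: "nat \<Rightarrow> (nat \<Rightarrow> 'a::field) set \<Rightarrow> (nat set \<Rightarrow> 'a) set \<Rightarrow> bool" where
  "pl_in n L W = (\<exists>u. eq_rep (n + 3) L u \<and> pluecker (n + 3) u \<in> W)"

definition setA :: "nat \<Rightarrow> nat \<Rightarrow> (nat \<Rightarrow> 'a::field) set \<Rightarrow> 'a \<Rightarrow> 'a \<Rightarrow> (nat \<Rightarrow> 'a) set set" where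
  "setA n r L0 a b = {L \<in> grass n.
     L \<subseteq> lspan (L0 \<union> osc (n + 2) (int r + 1) a b) \<and>
     pdim (L \<inter> osc (n + 2) (int r - 1) a b) \<ge> int r - 2}"

definition setB :: "nat \<Rightarrow> nat \<Rightarrow> (nat \<Rightarrow> 'a::field) set \<Rightarrow> 'a \<Rightarrow> 'a \<Rightarrow> (nat \<Rightarrow> 'a) set set" where
  "setB n r L0 a b = {L \<in> grass n.
     osc (n + 2) (int r - 2) a b \<subseteq> L \<and>
     pdim (L \<inter> osc (n + 2) (int r) a b) \<ge> int r - 1 \<and>
     pdim (L \<inter> lspan (L0 \<union> osc (n + 2) (int r) a b)) \<ge> int n - 2}"

definition setC :: "nat \<Rightarrow> nat \<Rightarrow> (nat \<Rightarrow> 'a::field) set \<Rightarrow> 'a \<Rightarrow> 'a \<Rightarrow> (nat \<Rightarrow> 'a) set set" where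
  "setC n r L0 a b = {L \<in> grass n.
     osc (n + 2) (int r - 1) a b \<subseteq> L \<and>
     pdim (L \<inter> L0) \<ge> int n - 3}"

end

(*
  For vectors x, y, z the determinant D(x,y,z) = det(<u_a, x>, <u_a, y>, <u_a, z>) is a linear
  form in the dual Pluecker coordinates of the plane Lambda cut out by u, and it vanishes exactly
  when x, y, z are linearly dependent modulo Lambda.  A form D that vanishes to third order along
  every arc of Z_y therefore vanishes on the second osculating space.

  Let q_0, q_1, ... be the Taylor vectors of the curve at y, so that O^k_y is spanned by
  q_0, ..., q_k.  Along an arc of Z_y the three equations keep a root of order r, hence modulo t^3
  the column of q_{r-1} is alpha col(q_r) + beta col(q_{r+1}) with t | alpha and t^2 | beta, and
  for i <= r-2 the column of q_i is gamma col(q_r) with t^2 | gamma, while the columns of vectors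
  of Lambda_0 are divisible by t.  With L1 = <Lambda_0, q_r> and L2 = <L1, q_{r+1}> this makes the
  following D vanish to third order:
    (q_i, L1, any) for i <= r-2,   (q_{r-1}, L1, L1),   (q_{r-1}, q_r, L2),
    (q_{r-1}, q_r, any) if q_{r+1} is in L1,   (Lambda_0, Lambda_0, Lambda_0).
  Comparing dimensions, Lambda lies in A if it misses some q_i with i <= r-2, in A or B if it
  contains those but misses q_{r-1}, and in C if it contains q_0, ..., q_{r-1}.
*)
theory Submission
  imports Defs
begin

section \<open>Dimension counts inside a finitely spanned ambient space\<close>

context vector_space
begin

lemma span_insert_subset_ambient:
  assumes "S \<subseteq> span E" "x \<in> span E"
  shows "span (insert x S) \<subseteq> span E"
  using assms by (intro span_minimal) auto

context
  fixes E :: "'b set"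
  assumes finE: "finite E"
begin

text \<open>The functions on the naturals form an infinite-dimensional space, so dimensions are
  compared inside the span of a finite set \<open>E\<close>. This makes the chosen basis of
  \<open>S\<close> finite, and adjoining \<open>x\<close> raises its cardinality by exactly
  one.\<close>

lemma dim_span_insert_notin:
  assumes "subspace S" "S \<subseteq> span E" "x \<notin> S"
  shows "dim (span (insert x S)) = Suc (dim S)"
proof -
  obtain B where B: "B \<subseteq> S" "independent B" "S \<subseteq> span B" "card B = dim S"
    by (rule basis_exists)
  have sB: "span B = S"
    using B assms(1) by (simp add: span_minimal subset_antisym)
  have fB: "finite B"
    using independent_span_bound[OF finE B(2)] B(1) assms(2) by blast
  have xB: "x \<notin> B" using B(1) assms(3) by blast
  have i: "independent (insert x B)"
    using independent_insertI[OF _ B(2)] sB assms(3) by simp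
  have "span (insert x S) = span (insert x B)"
    unfolding set_eq_iff span_breakdown_eq using sB by (metis span_span)
  then have "dim (span (insert x S)) = card (insert x B)"
    using dim_span_eq_card_independent[OF i] by simp
  then show ?thesis using fB xB B(4) by simp
qed

lemma dim_subset_le:
  assumes "S \<subseteq> T" "T \<subseteq> span E"
  shows "dim S \<le> dim T"
proof -
  obtain B where B: "B \<subseteq> T" "independent B" "T \<subseteq> span B" "card B = dim T"
    by (rule basis_exists)
  have fB: "finite B"
    using independent_span_bound[OF finE B(2)] B(1) assms(2) by blast
  have "dim S \<le> card B"
    by (rule dim_le_card[OF _ fB]) (use assms(1) B(3) in blast)
  then show ?thesis using B(4) by simp
qed

lemma subspace_eq_of_dim_ge:
  assumes "subspace S" "S \<subseteq> T" "T \<subseteq> span E" "subspace T" "dim T \<le> dim S"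
  shows "S = T"
proof (rule ccontr)
  assume "S \<noteq> T"
  then obtain x where x: "x \<in> T" "x \<notin> S" using assms(2) by blast
  have "dim (span (insert x S)) = Suc (dim S)"
    using dim_span_insert_notin[OF assms(1) _ x(2)] assms(2,3) by blast
  moreover have "span (insert x S) \<subseteq> T"
    using x(1) assms(2,4) by (intro span_minimal) auto
  ultimately show False
    using dim_subset_le[OF _ assms(3)] assms(5) by (metis not_less_eq_eq)
qed

lemma dim_span_insert_le:
  assumes "subspace S" "S \<subseteq> span E"
  shows "dim (span (insert x S)) \<le> Suc (dim S)"
proof (cases "x \<in> S")
  case True
  then show ?thesis by (simp add: insert_absorb)
next
  case False
  then show ?thesis using dim_span_insert_notin[OF assms] by simp
qed

text \<open>\<open>L\<close> has codimension at most one in \<open>span (insert x L)\<close>, so it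
  cuts \<open>S\<close> in codimension at most one. If \<open>s\<close> is in \<open>S\<close> but
  not in \<open>L\<close>, every element of \<open>S\<close> becomes an element of \<open>L\<close>
  after subtracting a multiple of \<open>s\<close>.\<close>

lemma dim_le_Suc_dim_Int:
  assumes S: "subspace S" "S \<subseteq> span E" and L: "subspace L" and SL: "S \<subseteq> span (insert x L)"
  shows "dim S \<le> Suc (dim (S \<inter> L))"
proof (cases "S \<subseteq> L")
  case True
  then show ?thesis by (simp add: Int_absorb2)
next
  case False
  then obtain s where s: "s \<in> S" "s \<notin> L" by blast
  have sL: "span L = L" using L by simp
  obtain k where k: "s - k *s x \<in> L"
    using subsetD[OF SL s(1)] by (auto simp: span_breakdown_eq sL)
  have k0: "k \<noteq> 0" using k s(2) by auto
  have "S \<subseteq> span (insert s (S \<inter> L))"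
  proof
    fix v assume v: "v \<in> S"
    obtain m where m: "v - m *s x \<in> L" using subsetD[OF SL v] by (auto simp: span_breakdown_eq sL)
    \<comment> \<open>Both \<open>s\<close> and \<open>v\<close> are congruent modulo
      \<open>L\<close> to multiples of \<open>x\<close>; the factor \<open>m / k\<close> makes the
      two multiples cancel.\<close>
    have "(m / k) *s (s - k *s x) \<in> L" using k L by (simp add: subspace_scale)
    then have "(v - m *s x) - (m / k) *s (s - k *s x) \<in> L"
      using m L by (simp add: subspace_diff)
    moreover have "(v - m *s x) - (m / k) *s (s - k *s x) = v - (m / k) *s s"
      using k0 by (simp add: scale_right_diff_distrib)
    ultimately have "v - (m / k) *s s \<in> L" by simp
    moreover have "v - (m / k) *s s \<in> S"
      using v s(1) S(1) by (simp add: subspace_diff subspace_scale)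
    ultimately show "v \<in> span (insert s (S \<inter> L))"
      unfolding span_breakdown_eq by (blast intro: span_base)
  qed
  moreover have "span (insert s (S \<inter> L)) \<subseteq> span E"
    using S s by (intro span_insert_subset_ambient) auto
  ultimately have "dim S \<le> dim (span (insert s (S \<inter> L)))"
    by (rule dim_subset_le)
  also have "\<dots> \<le> Suc (dim (S \<inter> L))"
    by (rule dim_span_insert_le) (use S L in \<open>auto intro: subspace_inter\<close>)
  finally show ?thesis .
qed

lemma dim_le_dim_Int_add2:
  assumes S: "subspace S" "S \<subseteq> span E" and L: "subspace L"
    and SL: "S \<subseteq> span (insert x (span (insert x' L)))"
  shows "dim S \<le> dim (S \<inter> L) + 2"
proof -
  have "dim S \<le> Suc (dim (S \<inter> span (insert x' L)))"
    by (rule dim_le_Suc_dim_Int[OF S _ SL]) simp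
  also have "dim (S \<inter> span (insert x' L)) \<le> Suc (dim ((S \<inter> span (insert x' L)) \<inter> L))"
    by (rule dim_le_Suc_dim_Int) (use S L in \<open>auto intro: subspace_inter\<close>)
  also have "(S \<inter> span (insert x' L)) \<inter> L = S \<inter> L"
    by (auto intro: span_base)
  finally show ?thesis by simp
qed

end

end

section \<open>Determinants of three columns and dual Pluecker coordinates\<close>

definition dot :: "nat \<Rightarrow> (nat \<Rightarrow> 'b::comm_ring_1) \<Rightarrow> (nat \<Rightarrow> 'b) \<Rightarrow> 'b" where
  "dot N w z = (\<Sum>j<N. w j * z j)"

definition det_cols :: "(nat \<Rightarrow> 'b::comm_ring_1) \<Rightarrow> (nat \<Rightarrow> 'b) \<Rightarrow> (nat \<Rightarrow> 'b) \<Rightarrow> 'b" where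
  "det_cols x y z = det3 (\<lambda>a b. if b = 0 then x a else if b = 1 then y a else z a)"

lemma det_cols_eq:
  "det_cols x y z = x 0 * y 1 * z 2 + y 0 * z 1 * x 2 + z 0 * x 1 * y 2
          - z 0 * y 1 * x 2 - x 0 * z 1 * y 2 - y 0 * x 1 * z 2"
  by (simp add: det_cols_def det3_def)

lemma det_cols_add:
  "det_cols (\<lambda>a. x a + x' a) y z = det_cols x y z + det_cols x' y z"
  "det_cols x (\<lambda>a. y a + y' a) z = det_cols x y z + det_cols x y' z"
  "det_cols x y (\<lambda>a. z a + z' a) = det_cols x y z + det_cols x y z'"
  unfolding det_cols_eq by (simp_all add: algebra_simps)

lemma det_cols_mult:
  "det_cols (\<lambda>a. c * x a) y z = c * det_cols x y z"
  "det_cols x (\<lambda>a. c * y a) z = c * det_cols x y z"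
  "det_cols x y (\<lambda>a. c * z a) = c * det_cols x y z"
  unfolding det_cols_eq by (simp_all add: algebra_simps)

lemma det_cols_alt:
  "det_cols x x z = 0" "det_cols x y x = 0" "det_cols x y y = 0"
  unfolding det_cols_eq by (simp_all add: algebra_simps)

lemma det_cols_cong:
  assumes "\<And>a. a < 3 \<Longrightarrow> x a = x' a" "\<And>a. a < 3 \<Longrightarrow> y a = y' a" "\<And>a. a < 3 \<Longrightarrow> z a = z' a"
  shows "det_cols x y z = det_cols x' y' z'"
  using assms[of 0] assms[of 1] assms[of 2] unfolding det_cols_eq by simp

text \<open>This is the Levi-Civita symbol: the sign of the permutation that sorts three distinct
  indices, and 0 as soon as two of them coincide.\<close>

definition sgn3 :: "nat \<Rightarrow> nat \<Rightarrow> nat \<Rightarrow> 'b::comm_ring_1" where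
  "sgn3 i j k =
     (if i < j \<and> j < k \<or> j < k \<and> k < i \<or> k < i \<and> i < j then 1
      else if i < k \<and> k < j \<or> k < j \<and> j < i \<or> j < i \<and> i < k then - 1 else 0)"

text \<open>The cross product of two rows is orthogonal to both, and to the third row
  exactly when the determinant vanishes.\<close>
lemma det_cols_eq_0_imp_dependent:
  fixes x y z :: "nat \<Rightarrow> 'b::field"
  assumes "det_cols x y z = 0"
  shows "\<exists>p q s. (p, q, s) \<noteq> (0, 0, 0) \<and> (\<forall>a<3. p * x a + q * y a + s * z a = 0)"
proof -
  have less3: "a < 3 \<longleftrightarrow> a = 0 \<or> a = 1 \<or> a = 2" for a :: nat by auto
  \<comment> \<open>\<open>(P i k, Q i k, S i k)\<close> is the cross product of rows i and k of the
    matrix with columns \<open>x\<close>, \<open>y\<close>, \<open>z\<close>.\<close>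
  define P where "P i k = y i * z k - z i * y k" for i k
  define Q where "Q i k = z i * x k - x i * z k" for i k
  define S where "S i k = x i * y k - y i * x k" for i k
  have *: "P i k * x a + Q i k * y a + S i k * z a = 0" if "i < 3" "k < 3" "a < 3" for i k a
  proof -
    have "P i k * x a + Q i k * y a + S i k * z a = sgn3 i k a * det_cols x y z"
      using that unfolding less3 det_cols_eq P_def Q_def S_def
      by (elim disjE) (simp_all add: sgn3_def algebra_simps)
    then show ?thesis using assms by simp
  qed
  show ?thesis
  proof (cases "\<exists>i<3. \<exists>k<3. (P i k, Q i k, S i k) \<noteq> (0, 0, 0)")
    case True
    then show ?thesis using * by blast
  next
    \<comment> \<open>All these 2x2 minors vanish, so \<open>x\<close> and \<open>y\<close> alone
      are dependent: a nonzero entry of \<open>x\<close> or \<open>y\<close> in some row i gives the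
      coefficients \<open>(- y i, x i, 0)\<close>, and without such an entry \<open>x\<close> is
      zero.\<close>
    case False
    then have par: "P i k = 0" "Q i k = 0" "S i k = 0" if "i < 3" "k < 3" for i k
      using that by auto
    consider i where "i < 3" "x i \<noteq> 0 \<or> y i \<noteq> 0" | "\<forall>i<3. x i = 0 \<and> y i = 0" by blast
    then show ?thesis
    proof cases
      case 1
      have "\<forall>a<3. (- y i) * x a + x i * y a + 0 * z a = 0"
        using par(3)[OF 1(1)] by (auto simp: S_def algebra_simps)
      then show ?thesis using 1(2) by (metis neg_equal_0_iff_equal prod.inject)
    next
      case 2
      then have "\<forall>a<3. 1 * x a + 0 * y a + 0 * z a = 0" by simp
      then show ?thesis by (metis prod.inject one_neq_zero)
    qed
  qed
qed

lemma sgn3_fps: "sgn3 i j k = fps_const (sgn3 i j k)"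
  by (simp add: sgn3_def flip: fps_const_neg)

lemma sorted_list_of_set_3:
  fixes i j k :: nat
  assumes "i < j" "j < k"
  shows "sorted_list_of_set {i, j, k} = [i, j, k]"
  using assms by (intro sorted_list_of_set.sorted_key_list_of_set_unique[THEN iffD1]) auto

lemma pluecker_3:
  assumes "i < j" "j < k" "k < N"
  shows "pluecker N u {i, j, k} = det_cols (\<lambda>a. u a i) (\<lambda>a. u a j) (\<lambda>a. u a k)"
proof -
  have "card {i, j, k} = 3" "{i, j, k} \<subseteq> {..<N}" using assms by auto
  then show ?thesis
    using sorted_list_of_set_3[OF assms(1,2)]
    by (simp add: pluecker_def det_cols_eq det3_def)
qed

text \<open>Pluecker coordinates are indexed by sets and forget the order of the columns; the sign
  restores it. For repeated indices both sides vanish.\<close>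

lemma det_cols_eq_pluecker:
  assumes "i < N" "j < N" "k < N"
  shows "det_cols (\<lambda>a. u a i) (\<lambda>a. u a j) (\<lambda>a. u a k) = sgn3 i j k * pluecker N u {i, j, k}"
proof -
  have perm: "{i, k, j} = {i, j, k}" "{j, i, k} = {i, j, k}" "{j, k, i} = {i, j, k}"
    "{k, i, j} = {i, j, k}" "{k, j, i} = {i, j, k}" by auto
  consider "i = j \<or> j = k \<or> i = k" | "i < j" "j < k" | "i < k" "k < j" | "j < i" "i < k"
    | "j < k" "k < i" | "k < i" "i < j" | "k < j" "j < i" by linarith
  then show ?thesis
  proof cases
    case 1
    then show ?thesis by (auto simp: det_cols_alt sgn3_def)
  next
    case 2
    then show ?thesis using pluecker_3[of i j k N u] assms by (simp add: sgn3_def)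
  next
    case 3
    then show ?thesis using pluecker_3[of i k j N u] assms
      by (simp add: sgn3_def perm det_cols_eq algebra_simps)
  next
    case 4
    then show ?thesis using pluecker_3[of j i k N u] assms
      by (simp add: sgn3_def perm det_cols_eq algebra_simps)
  next
    case 5
    then show ?thesis using pluecker_3[of j k i N u] assms
      by (simp add: sgn3_def perm det_cols_eq algebra_simps)
  next
    case 6
    then show ?thesis using pluecker_3[of k i j N u] assms
      by (simp add: sgn3_def perm det_cols_eq algebra_simps)
  next
    case 7
    then show ?thesis using pluecker_3[of k j i N u] assms
      by (simp add: sgn3_def perm det_cols_eq algebra_simps)
  qed
qed

lemma det_cols_sum:
  "det_cols (\<lambda>a. \<Sum>i\<in>A. X i a) y z = (\<Sum>i\<in>A. det_cols (X i) y z)"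
  "det_cols x (\<lambda>a. \<Sum>i\<in>A. Y i a) z = (\<Sum>i\<in>A. det_cols x (Y i) z)"
  "det_cols x y (\<lambda>a. \<Sum>i\<in>A. Z i a) = (\<Sum>i\<in>A. det_cols x y (Z i))"
  by (simp_all add: det_cols_eq sum.distrib sum_subtractf sum_distrib_left sum_distrib_right)

text \<open>Contraction of the trivector of \<open>x\<close>, \<open>y\<close>, \<open>z\<close>
  with a Pluecker vector \<open>P\<close>. Summing over all ordered triples keeps it visibly linear
  in \<open>P\<close> and in each vector.\<close>

definition pl_form :: "nat \<Rightarrow> (nat \<Rightarrow> 'b::comm_ring_1) \<Rightarrow> (nat \<Rightarrow> 'b) \<Rightarrow> (nat \<Rightarrow> 'b) \<Rightarrow>
    (nat set \<Rightarrow> 'b) \<Rightarrow> 'b" where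
  "pl_form N x y z P =
     (\<Sum>i<N. \<Sum>j<N. \<Sum>k<N. x i * (y j * (z k * (sgn3 i j k * P {i, j, k}))))"

text \<open>A Cauchy-Binet formula, obtained by expanding each column multilinearly. It exhibits the
  determinant as a linear form in the Pluecker coordinates.\<close>

lemma det_cols_dot:
  "det_cols (\<lambda>a. dot N (u a) x) (\<lambda>a. dot N (u a) y) (\<lambda>a. dot N (u a) z)
     = pl_form N x y z (pluecker N u)"
proof -
  have "det_cols (\<lambda>a. dot N (u a) x) (\<lambda>a. dot N (u a) y) (\<lambda>a. dot N (u a) z)
    = (\<Sum>i<N. \<Sum>j<N. \<Sum>k<N. x i * (y j * (z k *
         det_cols (\<lambda>a. u a i) (\<lambda>a. u a j) (\<lambda>a. u a k))))"
    unfolding dot_def det_cols_sum by (simp add: det_cols_mult mult.commute[of "u _ _"])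
  also have "\<dots> = pl_form N x y z (pluecker N u)"
    unfolding pl_form_def by (intro sum.cong refl) (simp add: det_cols_eq_pluecker)
  finally show ?thesis .
qed

text \<open>The coefficients of the form are constant in t, so it can be evaluated on the jets of an
  arc one order at a time.\<close>

lemma fps_nth_pl_form:
  "fps_nth (pl_form N (\<lambda>j. fps_const (x j)) (\<lambda>j. fps_const (y j)) (\<lambda>j. fps_const (z j)) P) m
     = pl_form N x y z (\<lambda>S. fps_nth (P S) m)"
  unfolding pl_form_def sgn3_fps by (simp add: fps_sum_nth)

section \<open>Taylor vectors of the rational normal curve and coefficients near a multiple
  root\<close>

definition taylor_rnc :: "nat \<Rightarrow> 'a::comm_ring_1 \<Rightarrow> 'a \<Rightarrow> 'a \<Rightarrow> 'a \<Rightarrow> nat \<Rightarrow> nat \<Rightarrow> 'a" where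
  "taylor_rnc d a b c e i = (\<lambda>j. if j \<le> d then coeff ([:a, c:] ^ (d - j) * [:b, e:] ^ j) i else 0)"

lemma degree_mult_linear_power:
  fixes a b c e :: "'a::comm_ring_1"
  shows "degree ([:a, c:] ^ k * [:b, e:] ^ l) \<le> k + l"
proof -
  have l: "degree [:x, y:] \<le> 1" for x y :: 'a by simp
  have "degree ([:a, c:] ^ k) \<le> k"
    using degree_power_le[of "[:a, c:]" k] l[of a c] by (metis mult_1 mult_le_mono1 order_trans)
  moreover have "degree ([:b, e:] ^ l) \<le> l"
    using degree_power_le[of "[:b, e:]" l] l[of b e] by (metis mult_1 mult_le_mono1 order_trans)
  ultimately show ?thesis
    using degree_mult_le[of "[:a, c:] ^ k" "[:b, e:] ^ l"] by linarith
qed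

locale ring_map =
  fixes h :: "'a::comm_ring_1 \<Rightarrow> 'b::comm_ring_1"
  assumes h0: "h 0 = 0" and h1: "h 1 = 1" and hadd: "h (x + y) = h x + h y"
    and hmult: "h (x * y) = h x * h y"
begin

text \<open>Scalars are carried along the ring homomorphism \<open>h\<close> because those of K are
  used both in polynomials over K and in polynomials over K[[t]].\<close>

definition homogenize :: "nat \<Rightarrow> 'a poly \<Rightarrow> 'b \<Rightarrow> 'b \<Rightarrow> 'b" where
  "homogenize d p X Y = (\<Sum>i\<le>d. h (coeff p i) * X ^ (d - i) * Y ^ i)"

lemma homogenize_mult_linear:
  assumes "degree p \<le> d"
  shows "homogenize (Suc d) ([:a, c:] * p) X Y = (h a * X + h c * Y) * homogenize d p X Y"
proof -
  have z: "coeff p (Suc d) = 0" using assms by (simp add: coeff_eq_0)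
  have c: "coeff ([:a, c:] * p) i = a * coeff p i + (case i of 0 \<Rightarrow> 0 | Suc k \<Rightarrow> c * coeff p k)" for i
    by (simp add: mult_pCons_left coeff_pCons split: nat.split)
  have "homogenize (Suc d) ([:a, c:] * p) X Y =
      (\<Sum>i\<le>Suc d. h a * h (coeff p i) * X ^ (Suc d - i) * Y ^ i)
    + (\<Sum>i\<le>Suc d. h (case i of 0 \<Rightarrow> 0 | Suc k \<Rightarrow> c * coeff p k) * X ^ (Suc d - i) * Y ^ i)"
    unfolding homogenize_def c by (simp add: hadd hmult algebra_simps sum.distrib del: sum.atMost_Suc)
  also have "(\<Sum>i\<le>Suc d. h a * h (coeff p i) * X ^ (Suc d - i) * Y ^ i)
     = h a * X * homogenize d p X Y"
    unfolding homogenize_def by (simp add: z h0 sum_distrib_left Suc_diff_le algebra_simps)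
  also have "(\<Sum>i\<le>Suc d. h (case i of 0 \<Rightarrow> 0 | Suc k \<Rightarrow> c * coeff p k) * X ^ (Suc d - i) * Y ^ i)
     = h c * Y * homogenize d p X Y"
    unfolding homogenize_def
    by (subst sum.atMost_Suc_shift) (simp add: h0 hmult sum_distrib_left algebra_simps)
  finally show ?thesis by (simp add: algebra_simps)
qed

lemma homogenize_mult_linear_power:
  "homogenize (k + l) ([:a, c:] ^ k * [:b, e:] ^ l) X Y
     = (h a * X + h c * Y) ^ k * (h b * X + h e * Y) ^ l"
proof (induction k)
  case 0
  show ?case
  proof (induction l)
    case 0
    then show ?case by (simp add: homogenize_def h1)
  next
    case (Suc l)
    then show ?case
      using homogenize_mult_linear[of "[:b, e:] ^ l" l b e X Y] degree_mult_linear_power[of 0 0 0 b e l]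
      by (simp add: algebra_simps)
  qed
next
  case (Suc k)
  then show ?case
    using homogenize_mult_linear[of "[:a, c:] ^ k * [:b, e:] ^ l" "k + l" a c X Y]
      degree_mult_linear_power[of a c k b e l]
    by (simp add: algebra_simps)
qed

text \<open>The curve at X (a,b) + Y (c,e) is the sum of the Taylor vectors q_i with weights X^(d-i)
  Y^i. Different choices of X and Y give the moving root, the change of direction and the inverse
  frame below.\<close>

lemma taylor_rnc_expansion:
  assumes "j \<le> d"
  shows "(h a * X + h c * Y) ^ (d - j) * (h b * X + h e * Y) ^ j
     = (\<Sum>i\<le>d. h (taylor_rnc d a b c e i j) * X ^ (d - i) * Y ^ i)"
  using homogenize_mult_linear_power[of "d - j" j a c b e X Y] assms
  by (simp add: homogenize_def taylor_rnc_def)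

end

text \<open>The hypothesis says that the polynomial with coefficients G i has a zero of order
  at least r at Q.\<close>
lemma taylor_coeffs_near_root:
  fixes G :: "nat \<Rightarrow> 'b::comm_ring_1"
  assumes Q: "t dvd Q" and S: "\<And>m. m < r \<Longrightarrow> (\<Sum>i\<le>d. of_nat (i choose m) * Q ^ (i - m) * G i) = 0"
    and r: "r < d" "r \<ge> 1"
  shows "t ^ 3 dvd G (r - 1) + of_nat r * Q * G r + of_nat (Suc r choose 2) * Q\<^sup>2 * G (Suc r)"
    and "i + 3 \<le> r \<Longrightarrow> t ^ 3 dvd G i"
    and "i + 2 = r \<Longrightarrow> t ^ 3 dvd G i - (of_nat (r * (r - 1)) - of_nat (r choose 2)) * Q\<^sup>2 * G r"
proof -
  have Qp: "t ^ k dvd Q ^ m" if "k \<le> m" for k m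
    using that Q by (meson dvd_power_le le_imp_power_dvd dvd_power_same dvd_trans)
  \<comment> \<open>Induction on \<open>r - i\<close>, thus downwards from i = r: the i-th equation
    is solved for \<open>G i\<close>, which occurs there with coefficient 1.\<close>
  have low: "t ^ (r - i) dvd G i" if "i \<le> r" for i
    using that
  proof (induction "r - i" arbitrary: i rule: less_induct)
    case less
    show ?case
    proof (cases "i = r")
      case False
      then have ir: "i < r" using less.prems by simp
      have "0 = (\<Sum>k\<le>d. of_nat (k choose i) * Q ^ (k - i) * G k)" using S[OF ir] by simp
      also have "\<dots> = (\<Sum>k\<in>{..d} - {i}. of_nat (k choose i) * Q ^ (k - i) * G k) + G i"
        using ir r by (subst sum.remove[of _ i]) (auto simp: algebra_simps)
      finally have "G i = - (\<Sum>k\<in>{..d} - {i}. of_nat (k choose i) * Q ^ (k - i) * G k)"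
        by (simp add: eq_neg_iff_add_eq_0 add.commute)
      moreover have "t ^ (r - i) dvd of_nat (k choose i) * Q ^ (k - i) * G k"
        if k: "k \<in> {..d} - {i}" for k
      proof -
        consider "k < i" | "i < k" "k < r" | "r \<le> k" using k by force
        then show ?thesis
        proof cases
          case 1
          then show ?thesis by (simp add: binomial_eq_0)
        next
          case 2
          then have "t ^ (r - k) dvd G k" using less.hyps[of k] by simp
          then have "t ^ (k - i) * t ^ (r - k) dvd Q ^ (k - i) * G k"
            using Qp[of "k - i" "k - i"] by (intro mult_dvd_mono) auto
          moreover have "t ^ (k - i) * t ^ (r - k) = t ^ (r - i)"
            using 2 by (simp flip: power_add)
          ultimately show ?thesis by (simp add: mult.assoc)
        next
          case 3
          then show ?thesis using Qp[of "r - i" "k - i"] by (simp add: mult.assoc)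
        qed
      qed
      ultimately show ?thesis by (metis (no_types, lifting) dvd_minus_iff dvd_sum)
    qed simp
  qed
  show "t ^ 3 dvd G i" if "i + 3 \<le> r"
  proof -
    have "t ^ 3 dvd t ^ (r - i)" using that by (intro le_imp_power_dvd) simp
    then show ?thesis using low[of i] that by (meson dvd_trans le_add1 order_trans)
  qed
  \<comment> \<open>Modulo t^3 only the terms k = m, m+1, m+2 of the m-th equation survive;
    \<open>r < d\<close> keeps these indices within the sum.\<close>
  have two: "t ^ 3 dvd G m + of_nat (Suc m) * Q * G (Suc m)
      + of_nat (Suc (Suc m) choose 2) * Q\<^sup>2 * G (Suc (Suc m))" if m: "m < r" for m
  proof -
    let ?T = "\<lambda>k. of_nat (k choose m) * Q ^ (k - m) * G k"
    let ?A = "{m, Suc m, Suc (Suc m)}"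
    have A: "?A \<subseteq> {..d}" using m r by auto
    have "0 = sum ?T {..d}" using S[OF m] by simp
    also have "\<dots> = sum ?T ({..d} - ?A) + sum ?T ?A"
      using A by (intro sum.subset_diff) auto
    finally have "sum ?T ?A = - sum ?T ({..d} - ?A)"
      by (simp add: eq_neg_iff_add_eq_0 add.commute)
    moreover have "t ^ 3 dvd sum ?T ({..d} - ?A)"
    proof (rule dvd_sum)
      fix k assume k: "k \<in> {..d} - ?A"
      show "t ^ 3 dvd ?T k"
      proof (cases "k < m")
        case False
        then have "3 \<le> k - m" using k by auto
        then show ?thesis using Qp[of 3 "k - m"] by (simp add: mult.assoc)
      qed (simp add: binomial_eq_0)
    qed
    moreover have "sum ?T ?A = G m + of_nat (Suc m) * Q * G (Suc m)
      + of_nat (Suc (Suc m) choose 2) * Q\<^sup>2 * G (Suc (Suc m))"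
    proof -
      have "Suc (Suc m) choose m = Suc (Suc m) choose 2"
        using binomial_symmetric[of 2 "Suc (Suc m)"] by simp
      moreover have "Suc m choose m = Suc m" using binomial_Suc_n by blast
      ultimately show ?thesis
        by (simp del: binomial_Suc_Suc add: Suc_diff_le eval_nat_numeral add.assoc)
    qed
    ultimately show ?thesis by simp
  qed
  show r1: "t ^ 3 dvd G (r - 1) + of_nat r * Q * G r + of_nat (Suc r choose 2) * Q\<^sup>2 * G (Suc r)"
    using two[of "r - 1"] r by simp
  show "t ^ 3 dvd G i - (of_nat (r * (r - 1)) - of_nat (r choose 2)) * Q\<^sup>2 * G r" if i: "i + 2 = r"
  proof -
    have r': "r - 1 = Suc i" "r = Suc (Suc i)" using i by auto
    have a: "t ^ 3 dvd G i + of_nat (r - 1) * Q * G (r - 1) + of_nat (r choose 2) * Q\<^sup>2 * G r"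
      using two[of i] r' by simp
    \<comment> \<open>The relation for \<open>G (r - 1)\<close> is substituted into the one for
      \<open>G (r - 2)\<close>, which leaves a multiple of \<open>Q\<^sup>2 * G r\<close> and a term
      in \<open>Q ^ 3\<close> that is negligible modulo t^3.\<close>
    have b: "t ^ 3 dvd of_nat (r - 1) * Q *
        (G (r - 1) + of_nat r * Q * G r + of_nat (Suc r choose 2) * Q\<^sup>2 * G (Suc r))"
      using r1 by (rule dvd_mult)
    have c: "t ^ 3 dvd (of_nat (r - 1) * of_nat (Suc r choose 2) * G (Suc r)) * Q ^ 3"
      by (rule dvd_mult) (use Qp in simp)
    have "t ^ 3 dvd (G i + of_nat (r - 1) * Q * G (r - 1) + of_nat (r choose 2) * Q\<^sup>2 * G r)
      - of_nat (r - 1) * Q *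
        (G (r - 1) + of_nat r * Q * G r + of_nat (Suc r choose 2) * Q\<^sup>2 * G (Suc r))
      + (of_nat (r - 1) * of_nat (Suc r choose 2) * G (Suc r)) * Q ^ 3"
      using dvd_add[OF dvd_diff[OF a b] c] .
    also have "\<dots> = G i - (of_nat (r - 1) * of_nat r - of_nat (r choose 2)) * Q\<^sup>2 * G r"
      by (simp add: algebra_simps power2_eq_square power3_eq_cube)
    finally show ?thesis by (simp add: mult.commute)
  qed
qed

section \<open>Relations between the Taylor columns along an arc\<close>

lemma fps_X_power_dvd_iff: "fps_X ^ n dvd f \<longleftrightarrow> (\<forall>i<n. fps_nth f i = 0)"
  for f :: "'a::comm_ring_1 fps"
proof
  assume "\<forall>i<n. fps_nth f i = 0"
  then have "f = fps_X ^ n * fps_shift n f"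
    by (intro fps_ext) (simp add: fps_X_power_mult_nth)
  then show "fps_X ^ n dvd f" by (metis dvd_triv_left)
qed (auto simp: fps_X_power_mult_nth)

definition const_vec :: "(nat \<Rightarrow> 'a::comm_ring_1) \<Rightarrow> nat \<Rightarrow> 'a fps" where
  "const_vec v = (\<lambda>j. fps_const (v j))"

lemma smult_sum_right: "smult c (sum f A) = (\<Sum>i\<in>A. smult c (f i))"
  by (induction A rule: infinite_finite_induct) (simp_all add: smult_add_right)

text \<open>In the frame (a,b), (c,e) the moving point is p(a,b) + Q(c,e).\<close>
lemma vanishes_order_imp_taylor_sums:
  fixes ya yb :: "'a::field fps"
  assumes ace: "a * e - b * c = 1"
    and van: "vanishes_order d w ya yb r" and m: "m < r"
  defines "p \<equiv> ya * fps_const e - yb * fps_const c"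
    and "Q \<equiv> fps_const a * yb - fps_const b * ya"
  shows "(\<Sum>i\<le>d. of_nat (i choose m) * Q ^ (i - m) *
           (dot (Suc d) w (const_vec (taylor_rnc d a b c e i)) * p ^ (d - i))) = 0"
proof -
  interpret ring_map "\<lambda>x :: 'a. [:fps_const x:]"
    by unfold_locales (auto simp flip: fps_const_mult fps_const_add)
  have ace': "fps_const a * fps_const e - fps_const b * fps_const c = (1 :: 'a fps)"
    using ace by simp
  \<comment> \<open>Together with the next identity: if s is the polynomial variable, then (ya + s
    c, yb + s e) = p (a,b) + (Q + s) (c,e), so the pulled-back form becomes a polynomial in Q +
    s.\<close>
  have A: "[:fps_const a:] * [:p:] + [:fps_const c:] * [:Q, 1:] = [:ya, fps_const c:]"
  proof -
    have "fps_const a * p + fps_const c * Q = ya * (fps_const a * fps_const e - fps_const b * fps_const c)"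
      unfolding p_def Q_def by algebra
    then show ?thesis by (simp only: ace') (simp add: mult.commute)
  qed
  have B: "[:fps_const b:] * [:p:] + [:fps_const e:] * [:Q, 1:] = [:yb, fps_const e:]"
  proof -
    have "fps_const b * p + fps_const e * Q = yb * (fps_const a * fps_const e - fps_const b * fps_const c)"
      unfolding p_def Q_def by algebra
    then show ?thesis by (simp only: ace') (simp add: mult.commute)
  qed
  let ?q = "taylor_rnc d a b c e"
  have "(\<Sum>j\<le>d. smult (w j) ([:ya, fps_const c:] ^ (d - j) * [:yb, fps_const e:] ^ j))
     = (\<Sum>j\<le>d. \<Sum>i\<le>d. smult (w j * fps_const (?q i j) * p ^ (d - i)) ([:Q, 1:] ^ i))"
  proof (rule sum.cong[OF refl])
    fix j assume "j \<in> {..d}"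
    then have j: "j \<le> d" by simp
    have pp: "[:p:] ^ k = [:p ^ k:]" for k by (induction k) auto
    show "smult (w j) ([:ya, fps_const c:] ^ (d - j) * [:yb, fps_const e:] ^ j)
      = (\<Sum>i\<le>d. smult (w j * fps_const (?q i j) * p ^ (d - i)) ([:Q, 1:] ^ i))"
      using taylor_rnc_expansion[OF j, of a "[:p:]" c "[:Q, 1:]" b e] unfolding A B
      by (simp add: pp smult_sum_right ac_simps)
  qed
  also have "\<dots> = (\<Sum>i\<le>d. smult (dot (Suc d) w (const_vec (?q i)) * p ^ (d - i)) ([:Q, 1:] ^ i))"
    by (subst sum.swap) (simp add: dot_def const_vec_def lessThan_Suc_atMost sum_distrib_right smult_sum)
  finally have "coeff (\<Sum>i\<le>d. smult (dot (Suc d) w (const_vec (?q i)) * p ^ (d - i)) ([:Q, 1:] ^ i)) m = 0"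
    using van m unfolding vanishes_order_def by metis
  moreover have "coeff ([:Q, 1:] ^ i) m = of_nat (i choose m) * Q ^ (i - m)" for i
  proof (cases "m \<le> i")
    case True
    then show ?thesis by (simp add: coeff_linear_poly_power)
  next
    case False
    then have "degree ([:Q, 1:] ^ i) < m" by (simp add: degree_linear_power)
    then show ?thesis using False by (simp add: coeff_eq_0 binomial_eq_0)
  qed
  ultimately show ?thesis by (simp add: coeff_sum mult.commute)
qed

text \<open>The relations near a multiple root are divided by powers of the unit p. The multipliers
  \<open>\<alpha>\<close>, \<open>\<beta>\<close>, \<open>\<gamma>\<close> do not depend on the
  equation k, so these are relations between whole columns and can be inserted into
  determinants.\<close>

lemma taylor_columns_of_arc:
  fixes ya yb :: "'a::field fps" and u :: "nat \<Rightarrow> nat \<Rightarrow> 'a fps"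
  assumes ace: "a * e - b * c = 1" and van: "\<And>k. k < 3 \<Longrightarrow> vanishes_order d (u k) ya yb r"
    and y0: "fps_nth ya 0 = a" "fps_nth yb 0 = b" and r: "r < d" "r \<ge> 1"
  defines "\<psi> \<equiv> \<lambda>i k. dot (Suc d) (u k) (const_vec (taylor_rnc d a b c e i))"
  shows "\<exists>\<alpha> \<beta>. fps_X dvd \<alpha> \<and> fps_X\<^sup>2 dvd \<beta> \<and>
           (\<forall>k<3. fps_X ^ 3 dvd \<psi> (r - 1) k - (\<alpha> * \<psi> r k + \<beta> * \<psi> (Suc r) k))"
    and "\<And>i. i + 2 \<le> r \<Longrightarrow> \<exists>\<gamma>. fps_X\<^sup>2 dvd \<gamma> \<and> (\<forall>k<3. fps_X ^ 3 dvd \<psi> i k - \<gamma> * \<psi> r k)"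
proof -
  define p where "p = ya * fps_const e - yb * fps_const c"
  define Q where "Q = fps_const a * yb - fps_const b * ya"
  define G where "G k i = \<psi> i k * p ^ (d - i)" for k i
  have S: "(\<Sum>i\<le>d. of_nat (i choose m) * Q ^ (i - m) * G k i) = 0" if "m < r" "k < 3" for m k
    using vanishes_order_imp_taylor_sums[OF ace van[OF that(2)] that(1)]
    by (simp add: G_def \<psi>_def p_def Q_def)
  have Q: "fps_X dvd Q"
    using fps_X_power_dvd_iff[of 1 Q] y0 by (simp add: Q_def mult.commute)
  have Q2: "fps_X\<^sup>2 dvd Q\<^sup>2" using Q by (rule dvd_power_same)
  \<comment> \<open>At t = 0 the series p equals a e - b c = 1, hence it is a unit.\<close>
  have "fps_nth p 0 = 1" using y0 ace by (simp add: p_def mult.commute)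
  then have inv: "inverse p * p = 1" by (intro inverse_mult_eq_1) simp
  define s where "s = inverse p"
  have sp: "s ^ k * p ^ k = 1" for k using inv by (simp add: s_def flip: power_mult_distrib)
  have \<psi>: "\<psi> i k = s ^ (d - i) * G k i" for i k
    using sp[of "d - i"] by (simp add: G_def algebra_simps)
  note near = taylor_coeffs_near_root[OF Q S r]
  define \<alpha> where "\<alpha> = - (s ^ (d - (r - 1)) * (of_nat r * Q * p ^ (d - r)))"
  define \<beta> where "\<beta> = - (s ^ (d - (r - 1)) * (of_nat (Suc r choose 2) * Q\<^sup>2 * p ^ (d - Suc r)))"
  show "\<exists>\<alpha> \<beta>. fps_X dvd \<alpha> \<and> fps_X\<^sup>2 dvd \<beta> \<and>
           (\<forall>k<3. fps_X ^ 3 dvd \<psi> (r - 1) k - (\<alpha> * \<psi> r k + \<beta> * \<psi> (Suc r) k))"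
  proof (intro exI conjI allI impI)
    show "fps_X dvd \<alpha>" using Q by (simp add: \<alpha>_def)
    show "fps_X\<^sup>2 dvd \<beta>" using Q2 by (simp add: \<beta>_def)
    fix k :: nat assume k: "k < 3"
    have "fps_X ^ 3 dvd s ^ (d - (r - 1)) * (G k (r - 1) + of_nat r * Q * G k r
        + of_nat (Suc r choose 2) * Q\<^sup>2 * G k (Suc r))"
      using near(1)[of k] k by (intro dvd_mult) simp
    also have "\<dots> = \<psi> (r - 1) k - (\<alpha> * \<psi> r k + \<beta> * \<psi> (Suc r) k)"
      unfolding \<psi>[of "r - 1"] \<alpha>_def \<beta>_def G_def[of k r] G_def[of k "Suc r"]
      by algebra
    finally show "fps_X ^ 3 dvd \<psi> (r - 1) k - (\<alpha> * \<psi> r k + \<beta> * \<psi> (Suc r) k)" .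
  qed
  show "\<exists>\<gamma>. fps_X\<^sup>2 dvd \<gamma> \<and> (\<forall>k<3. fps_X ^ 3 dvd \<psi> i k - \<gamma> * \<psi> r k)" if i: "i + 2 \<le> r" for i
  proof (cases "i + 2 = r")
    case True
    let ?n = "of_nat (r * (r - 1)) - of_nat (r choose 2) :: 'a fps"
    show ?thesis
    proof (intro exI conjI allI impI)
      show "fps_X\<^sup>2 dvd s ^ (d - i) * (?n * Q\<^sup>2 * p ^ (d - r))" using Q2 by simp
      fix k :: nat assume k: "k < 3"
      have "fps_X ^ 3 dvd s ^ (d - i) * (G k i - ?n * Q\<^sup>2 * G k r)"
        using near(3)[of k] k True by (intro dvd_mult) simp
      then show "fps_X ^ 3 dvd \<psi> i k - s ^ (d - i) * (?n * Q\<^sup>2 * p ^ (d - r)) * \<psi> r k"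
        unfolding \<psi>[of i] G_def[of k r] by (simp only: algebra_simps)
    qed
  next
    case False
    \<comment> \<open>Below index r - 2 the column itself is divisible by t^3, and
      \<open>\<gamma>\<close> is 0.\<close>
    then have "i + 3 \<le> r" using i by simp
    then have "\<forall>k<3. fps_X ^ 3 dvd \<psi> i k - 0 * \<psi> r k"
      using near(2) unfolding \<psi>[of i] by simp
    then show ?thesis by (intro exI[of _ 0]) simp
  qed
qed

section \<open>Determinants divisible by the cube of the parameter\<close>

lemma det_cols_dvd:
  assumes "\<And>a. a < 3 \<Longrightarrow> l dvd x a" "\<And>a. a < 3 \<Longrightarrow> m dvd y a" "\<And>a. a < 3 \<Longrightarrow> n dvd z a"
  shows "l * m * n dvd det_cols x y z"
proof -
  obtain x' y' z' where xyz: "\<And>a. a < 3 \<Longrightarrow> x a = l * x' a" "\<And>a. a < 3 \<Longrightarrow> y a = m * y' a"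
    "\<And>a. a < 3 \<Longrightarrow> z a = n * z' a"
    using assms unfolding dvd_def by metis
  have "det_cols x y z = l * m * n * det_cols x' y' z'"
    using det_cols_cong[of x "\<lambda>a. l * x' a" y "\<lambda>a. m * y' a" z "\<lambda>a. n * z' a"] xyz
    by (simp add: det_cols_mult mult.assoc)
  then show ?thesis by simp
qed

lemma det_cols_dvd_cong:
  assumes "\<And>a. a < 3 \<Longrightarrow> m dvd x a - x' a" "m dvd det_cols x' y z"
  shows "m dvd det_cols x y z"
proof -
  have "m * 1 * 1 dvd det_cols (\<lambda>a. x a - x' a) y z"
    using assms(1) by (intro det_cols_dvd) auto
  moreover have "det_cols x y z = det_cols (\<lambda>a. x a - x' a) y z + det_cols x' y z"
    using det_cols_add(1)[of "\<lambda>a. x a - x' a" x' y z] by simp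
  ultimately show ?thesis using assms(2) by simp
qed

context
  fixes t :: "'b::comm_ring_1" and R R' :: "nat \<Rightarrow> 'b"
begin

text \<open>\<open>R\<close> and \<open>R'\<close> stand for the columns of q_r and q_{r+1},
  \<open>w\<close> for the column of a vector of Lambda_0. The multiple of \<open>R\<close> in the
  second column is killed by alternation; \<open>\<gamma>\<close> contributes t^2 and
  \<open>w\<close> contributes t.\<close>

lemma cube_dvd_det_cols_low:
  assumes x: "\<And>a. a < 3 \<Longrightarrow> t ^ 3 dvd x a - \<gamma> * R a" and g: "t\<^sup>2 dvd \<gamma>"
    and w: "\<And>a. a < 3 \<Longrightarrow> t dvd w a"
  shows "t ^ 3 dvd det_cols x (\<lambda>a. w a + k * R a) z"
proof (rule det_cols_dvd_cong[OF x])
  have "1 * t * 1 dvd det_cols R w z" by (rule det_cols_dvd) (use w in auto)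
  then have "t\<^sup>2 * t dvd \<gamma> * det_cols R w z" using g by (intro mult_dvd_mono) simp_all
  then show "t ^ 3 dvd det_cols (\<lambda>a. \<gamma> * R a) (\<lambda>a. w a + k * R a) z"
    by (simp add: det_cols_add det_cols_mult det_cols_alt power3_eq_cube power2_eq_square)
qed

context
  fixes x \<alpha> \<beta>
  assumes x: "\<And>a. a < 3 \<Longrightarrow> t ^ 3 dvd x a - (\<alpha> * R a + \<beta> * R' a)"
    and al: "t dvd \<alpha>" and be: "t\<^sup>2 dvd \<beta>"
begin

text \<open>After expansion four terms survive alternation. The \<open>\<alpha>\<close> term
  contains both \<open>w\<close> and \<open>w'\<close>; each \<open>\<beta>\<close> term contains at
  least one of them.\<close>

lemma cube_dvd_det_cols_middle:
  assumes w: "\<And>a. a < 3 \<Longrightarrow> t dvd w a" and w': "\<And>a. a < 3 \<Longrightarrow> t dvd w' a"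
  shows "t ^ 3 dvd det_cols x (\<lambda>a. w a + k * R a) (\<lambda>a. w' a + k' * R a)"
proof (rule det_cols_dvd_cong[OF x])
  have "1 * t * t dvd det_cols R w w'" by (rule det_cols_dvd) (use w w' in auto)
  then have a: "t * (t * t) dvd \<alpha> * det_cols R w w'" using al by (intro mult_dvd_mono) simp_all
  have "1 * t * 1 dvd det_cols R' w w'" by (rule det_cols_dvd) (use w in auto)
  then have b: "t\<^sup>2 * t dvd \<beta> * det_cols R' w w'" using be by (intro mult_dvd_mono) simp_all
  have "1 * t * 1 dvd det_cols R' w R" by (rule det_cols_dvd) (use w in auto)
  then have c: "t\<^sup>2 * t dvd \<beta> * (k' * det_cols R' w R)" using be by (intro mult_dvd_mono) simp_all
  have "1 * 1 * t dvd det_cols R' R w'" by (rule det_cols_dvd) (use w' in auto)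
  then have d: "t\<^sup>2 * t dvd \<beta> * (k * det_cols R' R w')" using be by (intro mult_dvd_mono) simp_all
  have "t ^ 3 dvd \<alpha> * det_cols R w w' + \<beta> * det_cols R' w w' + \<beta> * (k' * det_cols R' w R)
      + \<beta> * (k * det_cols R' R w')"
    using a b c d by (intro dvd_add) (simp_all add: power3_eq_cube power2_eq_square mult.assoc)
  also have "\<dots> = det_cols (\<lambda>a. \<alpha> * R a + \<beta> * R' a) (\<lambda>a. w a + k * R a) (\<lambda>a. w' a + k' * R a)"
    by (simp add: det_cols_add det_cols_mult det_cols_alt algebra_simps)
  finally show "t ^ 3 dvd \<dots>" .
qed

text \<open>With \<open>R\<close> as second column, only \<open>\<beta>\<close> times the
  determinant of \<open>R'\<close>, \<open>R\<close>, \<open>w\<close> survives.\<close>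

lemma cube_dvd_det_cols_top:
  assumes w: "\<And>a. a < 3 \<Longrightarrow> t dvd w a"
  shows "t ^ 3 dvd det_cols x R (\<lambda>a. w a + k * R a + k' * R' a)"
proof (rule det_cols_dvd_cong[OF x])
  have "1 * 1 * t dvd det_cols R' R w" by (rule det_cols_dvd) (use w in auto)
  then have "t\<^sup>2 * t dvd \<beta> * det_cols R' R w" using be by (intro mult_dvd_mono) simp_all
  then show "t ^ 3 dvd det_cols (\<lambda>a. \<alpha> * R a + \<beta> * R' a) R (\<lambda>a. w a + k * R a + k' * R' a)"
    by (simp add: det_cols_add det_cols_mult det_cols_alt power3_eq_cube power2_eq_square)
qed

text \<open>Here \<open>R'\<close> is \<open>w\<close> modulo \<open>R\<close>, so the missing
  factor t already comes from the first column and the third is arbitrary.\<close>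

lemma cube_dvd_det_cols_top':
  assumes w: "\<And>a. a < 3 \<Longrightarrow> t dvd w a" and R': "\<And>a. a < 3 \<Longrightarrow> R' a = w a + k * R a"
  shows "t ^ 3 dvd det_cols x R z"
proof (rule det_cols_dvd_cong[OF x])
  have "t * 1 * 1 dvd det_cols w R z" by (rule det_cols_dvd) (use w in auto)
  then have "t\<^sup>2 * t dvd \<beta> * det_cols w R z" using be by (intro mult_dvd_mono) simp_all
  moreover have "det_cols (\<lambda>a. \<alpha> * R a + \<beta> * R' a) R z
     = det_cols (\<lambda>a. \<alpha> * R a + \<beta> * (w a + k * R a)) R z"
    using R' by (intro det_cols_cong) auto
  ultimately show "t ^ 3 dvd det_cols (\<lambda>a. \<alpha> * R a + \<beta> * R' a) R z"
    by (simp add: det_cols_add det_cols_mult det_cols_alt power3_eq_cube power2_eq_square)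
qed

end

end

section \<open>Linear forms on the second osculating space and dependence modulo a plane\<close>

global_interpretation fs: vector_space "fscale :: 'a::field \<Rightarrow> ('i \<Rightarrow> 'a) \<Rightarrow> 'i \<Rightarrow> 'a"
  by unfold_locales (auto simp: fscale_def fun_eq_iff algebra_simps)

lemma dot_add: "dot N w (\<lambda>j. x j + y j) = dot N w x + dot N w y"
  by (simp add: dot_def algebra_simps sum.distrib)

lemma dot_mult: "dot N w (\<lambda>j. k * x j) = k * dot N w x"
  by (simp add: dot_def algebra_simps sum_distrib_left)

lemma dot_const_vec_add:
  "dot N w (const_vec (x + y)) = dot N w (const_vec x) + dot N w (const_vec y)"
  by (simp add: const_vec_def dot_add flip: fps_const_add)

lemma dot_const_vec_fscale:
  "dot N w (const_vec (fscale k x)) = fps_const k * dot N w (const_vec x)"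
  by (simp add: const_vec_def fscale_def dot_mult flip: fps_const_mult)

lemma subspace_vecs: "lsubspace (vecs N :: (nat \<Rightarrow> 'a::field) set)"
  by (auto simp: fs.subspace_def vecs_def fscale_def)

text \<open>Divisibility by t^3 along an arc says that the form kills the Taylor coefficients of
  orders 0, 1, 2 of the Pluecker vector. These generate \<open>osc2_Z\<close>, and linearity does
  the rest.\<close>

lemma pl_form_osc2_Z_eq_0:
  assumes P: "P \<in> osc2_Z n r L0 a b"
    and arcs: "\<And>u ya yb. arc_in_I n r L0 a b u ya yb \<Longrightarrow>
      fps_X ^ 3 dvd det_cols (\<lambda>k. dot (n + 3) (u k) (const_vec x)) (\<lambda>k. dot (n + 3) (u k) (const_vec y))
        (\<lambda>k. dot (n + 3) (u k) (const_vec z))"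
  shows "pl_form (n + 3) x y z P = 0"
  using P unfolding osc2_Z_def
proof (induction rule: fs.span_induct_alt)
  case base
  show ?case by (simp add: pl_form_def)
next
  case (step k P Q)
  then obtain u ya yb m where P: "P = (\<lambda>S. fps_nth (pluecker (n + 3) u S) m)"
    and arc: "arc_in_I n r L0 a b u ya yb" and m: "m \<le> 2" by blast
  have "fps_nth (pl_form (n + 3) (const_vec x) (const_vec y) (const_vec z) (pluecker (n + 3) u)) m = 0"
    using arcs[OF arc] m unfolding det_cols_dot fps_X_power_dvd_iff by simp
  then have 0: "pl_form (n + 3) x y z P = 0"
    unfolding const_vec_def fps_nth_pl_form P .
  have "pl_form (n + 3) x y z (fscale k P + Q) = k * pl_form (n + 3) x y z P + pl_form (n + 3) x y z Q"
    unfolding pl_form_def fscale_def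
    by (simp add: algebra_simps sum.distrib sum_distrib_left)
  then show ?case using 0 step by (simp add: plus_fun_def)
qed

text \<open>A relation between the three columns puts p x + q y + s z into \<open>L\<close>. The
  assumptions on \<open>x\<close> and \<open>y\<close> exclude s = 0, so the relation can be solved
  for \<open>z\<close>.\<close>

lemma eq_rep_det_eq_0_imp_dependent:
  fixes L :: "(nat \<Rightarrow> 'a::field) set"
  assumes rep: "eq_rep N L u" and L: "lsubspace L"
    and v: "x \<in> vecs N" "y \<in> vecs N" "z \<in> vecs N"
    and det: "det_cols (\<lambda>a. dot N (u a) x) (\<lambda>a. dot N (u a) y) (\<lambda>a. dot N (u a) z) = 0"
    and x: "x \<notin> L" and y: "y \<notin> lspan (insert x L)"
  shows "z \<in> lspan (insert y (lspan (insert x L)))"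
proof -
  obtain p q s where pqs: "(p, q, s) \<noteq> (0, 0, 0)"
    and eq: "\<And>a. a < 3 \<Longrightarrow> p * dot N (u a) x + q * dot N (u a) y + s * dot N (u a) z = 0"
    using det_cols_eq_0_imp_dependent[OF det] by blast
  have "dot N (u a) (fscale p x + fscale q y + fscale s z) = 0" if "a < 3" for a
    using eq[OF that] by (simp add: fscale_def dot_add dot_mult plus_fun_def)
  moreover have "fscale p x + fscale q y + fscale s z \<in> vecs N"
    using v by (intro fs.subspace_add fs.subspace_scale subspace_vecs)
  ultimately have inL: "fscale p x + fscale q y + fscale s z \<in> L"
    using rep unfolding eq_rep_def dot_def by simp
  let ?M = "lspan (insert x L)" let ?M' = "lspan (insert y ?M)"
  have LM: "L \<subseteq> ?M" "?M \<subseteq> ?M'" "x \<in> ?M" "y \<in> ?M'" by (auto intro: fs.span_base)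
  show ?thesis
  proof (cases "s = 0")
    case False
    have "fscale p x + fscale q y \<in> ?M'"
      using LM by (blast intro: fs.span_add fs.span_scale)
    then have "(fscale p x + fscale q y + fscale s z) - (fscale p x + fscale q y) \<in> ?M'"
      using inL LM by (blast intro: fs.span_diff)
    then have "fscale s z \<in> ?M'" by simp
    from fs.span_scale[OF this, of "1 / s"] show ?thesis using False by simp
  next
    case s: True
    show ?thesis
    proof (cases "q = 0")
      case False
      have "fscale p x \<in> ?M" using LM by (blast intro: fs.span_scale)
      moreover have "fscale p x + fscale q y \<in> ?M" using inL LM s by auto
      ultimately have "(fscale p x + fscale q y) - fscale p x \<in> ?M" by (blast intro: fs.span_diff)
      then have "fscale q y \<in> ?M" by simp
      from fs.span_scale[OF this, of "1 / q"] show ?thesis using False y by simp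
    next
      case True
      then have "fscale p x \<in> L" "p \<noteq> 0" using s inL pqs by auto
      from fs.subspace_scale[OF L this(1), of "1 / p"] show ?thesis
        using \<open>p \<noteq> 0\<close> x by simp
    qed
  qed
qed

section \<open>Linear algebra of the three cases\<close>

context vector_space
begin

lemma subspace_subset_span_insert: "subspace L \<Longrightarrow> L \<subseteq> span (insert x L)"
  by (auto intro: span_base)

text \<open>Geometry enters only through \<open>T\<close>, later taken to be third-order vanishing
  of the determinant form along all arcs. \<open>Q k\<close> is spanned by the first k Taylor
  vectors and so plays the role of O^{k-1}_y. The three alternatives are the linear versions of A, B
  and C.\<close>

lemma osculating_trichotomy:
  fixes q :: "nat \<Rightarrow> 'b" and T :: "'b \<Rightarrow> 'b \<Rightarrow> 'b \<Rightarrow> bool"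
  defines "Q \<equiv> \<lambda>k. span (q ` {..<k})"
  assumes finE: "finite E" and dimE: "dim (span E) = n + 3"
    and L0: "subspace L0" "L0 \<subseteq> span E" "dim L0 = n"
    and L: "subspace L" "L \<subseteq> span E" "dim L = n"
    and qE: "\<And>i. q i \<in> span E" and r: "r \<ge> 1"
    and dimQ: "r \<le> dim (Q r)" "Suc r \<le> dim (Q (Suc r))"
    and QL0: "Q r \<subseteq> L0" and qr: "q r \<notin> L0"
    and T: "\<And>x y z. T x y z \<Longrightarrow> x \<in> span E \<Longrightarrow> y \<in> span E \<Longrightarrow> z \<in> span E \<Longrightarrow> x \<notin> L \<Longrightarrow>
      y \<notin> span (insert x L) \<Longrightarrow> z \<in> span (insert y (span (insert x L)))"
    and L1: "L1 = span (insert (q r) L0)" and L2: "L2 = span (insert (q (Suc r)) L1)"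
    and T_low: "\<And>i y z. i + 2 \<le> r \<Longrightarrow> y \<in> L1 \<Longrightarrow> T (q i) y z"
    and T_middle: "\<And>y z. y \<in> L1 \<Longrightarrow> z \<in> L1 \<Longrightarrow> T (q (r - 1)) y z"
    and T_top: "\<And>z. z \<in> L2 \<Longrightarrow> T (q (r - 1)) (q r) z"
    and T_top': "\<And>z. q (Suc r) \<in> L1 \<Longrightarrow> T (q (r - 1)) (q r) z"
    and T_base: "\<And>x y z. x \<in> L0 \<Longrightarrow> y \<in> L0 \<Longrightarrow> z \<in> L0 \<Longrightarrow> T x y z"
  shows "L \<subseteq> L2 \<and> r \<le> Suc (dim (L \<inter> Q r)) \<or>
    Q (r - 1) \<subseteq> L \<and> r \<le> dim (L \<inter> Q (Suc r)) \<and> n \<le> Suc (dim (L \<inter> L1)) \<or>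
    Q r \<subseteq> L \<and> n \<le> dim (L \<inter> L0) + 2"
proof -
  note mono = dim_subset_le[OF finE]
  have QE: "Q k \<subseteq> span E" for k
    unfolding Q_def using qE by (intro span_minimal) auto
  have sQ: "subspace (Q k)" for k unfolding Q_def by simp
  have qQ: "q i \<in> Q k" if "i < k" for i k
    unfolding Q_def using that by (auto intro: span_base)
  have Q_le: "Q k \<subseteq> S" if "subspace S" "\<And>i. i < k \<Longrightarrow> q i \<in> S" for k S
    unfolding Q_def using that by (intro span_minimal) auto
  have sL1: "subspace L1" and sL2: "subspace L2" unfolding L1 L2 by simp_all
  have L1E: "L1 \<subseteq> span E" unfolding L1 using L0 qE by (intro span_insert_subset_ambient) auto
  have L2E: "L2 \<subseteq> span E" unfolding L2 using L1E qE by (intro span_insert_subset_ambient) auto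
  have L0L1: "L0 \<subseteq> L1" unfolding L1 using L0(1) by (rule subspace_subset_span_insert)
  have qrL1: "q r \<in> L1" unfolding L1 by (auto intro: span_base)
  have L1L2: "L1 \<subseteq> L2" unfolding L2 using sL1 by (rule subspace_subset_span_insert)
  have dimL1: "dim L1 = Suc n"
    unfolding L1 using dim_span_insert_notin[OF finE L0(1,2) qr] L0(3) by simp
  have adjE: "span (insert x L) \<subseteq> span E" if "x \<in> span E" for x
    using L that by (intro span_insert_subset_ambient) auto
  have adj2E: "span (insert y (span (insert x L))) \<subseteq> span E" if "x \<in> span E" "y \<in> span E" for x y
    using adjE[OF that(1)] that(2) by (rule span_insert_subset_ambient)
  have dim_adj2: "dim (span (insert y (span (insert x L)))) \<le> n + 2" if "x \<in> span E" for x y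
    using dim_span_insert_le[OF finE L(1,2), of x] L(3)
      dim_span_insert_le[OF finE _ adjE[OF that], of y] by simp
  \<comment> \<open>Otherwise the whole ambient space, of dimension n + 3, would lie in a span of
    dimension at most n + 2.\<close>
  have T_all: "y \<in> span (insert x L)"
    if "\<And>z. T x y z" "x \<in> span E" "y \<in> span E" "x \<notin> L" for x y
  proof (rule ccontr)
    assume "y \<notin> span (insert x L)"
    then have "span E \<subseteq> span (insert y (span (insert x L)))"
      using T[OF that(1,2,3) _ that(4)] by blast
    then have "dim (span E) \<le> n + 2"
      using mono[OF _ adj2E[OF that(2,3)]] dim_adj2[OF that(2), of y] by (meson order_trans)
    then show False using dimE by simp
  qed
  consider (A) i where "i + 2 \<le> r" "q i \<notin> L"
    | (B) "Q (r - 1) \<subseteq> L" "q (r - 1) \<notin> L" | (C) "Q r \<subseteq> L"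
  proof -
    have "Q (r - 1) \<subseteq> L" if "\<And>i. i + 2 \<le> r \<Longrightarrow> q i \<in> L"
      using that by (intro Q_le L) auto
    moreover have "Q r \<subseteq> L" if "Q (r - 1) \<subseteq> L" "q (r - 1) \<in> L"
    proof (rule Q_le[OF L(1)])
      fix i assume "i < r"
      then show "q i \<in> L" using that qQ[of i "r - 1"] by (cases "i = r - 1") auto
    qed
    ultimately show thesis using that by blast
  qed
  then show ?thesis
  proof cases
    case A
    have L1_sub: "L1 \<subseteq> span (insert (q i) L)"
      using T_all[OF T_low[OF A(1)] qE _ A(2)] L1E by blast
    \<comment> \<open>\<open>L1\<close> has dimension n + 1, so its intersection with
      \<open>L\<close> has dimension at least n and is all of \<open>L\<close>.\<close>
    have "dim L1 \<le> Suc (dim (L1 \<inter> L))"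
      by (rule dim_le_Suc_dim_Int[OF finE sL1 L1E L(1) L1_sub])
    then have "dim L \<le> dim (L1 \<inter> L)" using dimL1 L(3) by simp
    then have "L1 \<inter> L = L"
      using subspace_eq_of_dim_ge[OF finE _ _ L(2,1)] subspace_inter[OF sL1 L(1)] by blast
    then have "L \<subseteq> L2" using L1L2 by blast
    moreover have "dim (Q r) \<le> Suc (dim (Q r \<inter> L))"
      using QL0 L0L1 L1_sub by (intro dim_le_Suc_dim_Int[OF finE sQ QE L(1)]) blast
    ultimately show ?thesis using dimQ(1) by (simp add: Int_commute)
  next
    case B
    let ?M = "span (insert (q (r - 1)) L)"
    have rL0: "q (r - 1) \<in> L0" using qQ[of "r - 1" r] r QL0 by auto
    show ?thesis
    \<comment> \<open>If q_r lies in \<open>?M\<close>, then so does O^r_y and the second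
      alternative follows; otherwise the first one does.\<close>
    proof (cases "q r \<in> ?M")
      case True
      have QM: "Q (Suc r) \<subseteq> ?M"
      proof (rule Q_le)
        fix i assume "i < Suc r"
        then consider "i < r - 1" | "i = r - 1" | "i = r" using r by linarith
        then show "q i \<in> ?M"
          by cases (use B(1) qQ[of i "r - 1"] True in \<open>auto intro: span_base\<close>)
      qed simp
      have "dim (Q (Suc r)) \<le> Suc (dim (Q (Suc r) \<inter> L))"
        by (rule dim_le_Suc_dim_Int[OF finE sQ QE L(1) QM])
      \<comment> \<open>Any element of \<open>L1\<close> outside \<open>?M\<close> can serve as x,
        by \<open>T_middle\<close>; the value 0 covers the case that there is none.\<close>
      moreover have "\<exists>x. L1 \<subseteq> span (insert x ?M)"
      proof (cases "L1 \<subseteq> ?M")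
        case True
        then have "L1 \<subseteq> span (insert 0 ?M)" by (simp add: span_span)
        then show ?thesis by blast
      next
        case False
        then obtain y where y: "y \<in> L1" "y \<notin> ?M" by blast
        have "L1 \<subseteq> span (insert y ?M)"
          using T[OF T_middle[OF y(1)] qE _ _ B(2) y(2)] y(1) L1E by blast
        then show ?thesis by blast
      qed
      then obtain x where "L1 \<subseteq> span (insert x ?M)" by blast
      then have "dim L1 \<le> dim (L1 \<inter> L) + 2"
        by (rule dim_le_dim_Int_add2[OF finE sL1 L1E L(1)])
      ultimately show ?thesis using dimQ(2) B(1) dimL1 by (simp add: Int_commute)
    next
      case False
      \<comment> \<open>Otherwise \<open>T_top'\<close> leaves the third vector free, and
        \<open>T_all\<close> would put q_r into \<open>?M\<close>.\<close>
      have notin: "q (Suc r) \<notin> L1"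
        using T_all[OF T_top' qE qE B(2)] False by blast
      let ?M' = "span (insert (q r) ?M)"
      have L2M: "L2 \<subseteq> ?M'"
        using T[OF T_top qE qE _ B(2) False] L2E by blast
      have "dim L2 = n + 2"
        unfolding L2 using dim_span_insert_notin[OF finE sL1 L1E notin] dimL1 by simp
      \<comment> \<open>\<open>L2\<close> has dimension n + 2, the largest that \<open>?M'\<close>
        can have, so the inclusion is an equality.\<close>
      then have "L2 = ?M'"
        using subspace_eq_of_dim_ge[OF finE sL2 L2M adj2E[OF qE qE]] dim_adj2[OF qE] by simp
      then have "L \<subseteq> L2" using subspace_subset_span_insert[OF L(1)]
          subspace_subset_span_insert[OF subspace_span] by blast
      moreover have "r \<le> Suc (dim (L \<inter> Q r))"
      proof -
        have "Q r \<subseteq> ?M"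
        proof (rule Q_le)
          fix i assume "i < r"
          then consider "i = r - 1" | "i < r - 1" by linarith
          then show "q i \<in> ?M"
            by cases (use B(1) qQ[of i "r - 1"] in \<open>auto intro: span_base\<close>)
        qed simp
        then have "dim (Q r) \<le> Suc (dim (Q r \<inter> L))"
          by (rule dim_le_Suc_dim_Int[OF finE sQ QE L(1)])
        then show ?thesis using dimQ(1) by (simp add: Int_commute)
      qed
      ultimately show ?thesis by blast
    qed
  next
    case C
    \<comment> \<open>By \<open>T_base\<close>, two vectors of \<open>L0\<close> independent modulo
      \<open>L\<close> already span \<open>L0\<close> modulo \<open>L\<close>; zeros fill in when
      fewer exist.\<close>
    have "\<exists>x x'. L0 \<subseteq> span (insert x (span (insert x' L)))"
    proof (cases "L0 \<subseteq> L")
      case True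
      then have "L0 \<subseteq> span (insert 0 (span (insert 0 L)))"
        by (auto simp: span_span intro: span_base)
      then show ?thesis by blast
    next
      case False
      then obtain x where x: "x \<in> L0" "x \<notin> L" by blast
      show ?thesis
      proof (cases "L0 \<subseteq> span (insert x L)")
        case True
        then have "L0 \<subseteq> span (insert 0 (span (insert x L)))" by (simp add: span_span)
        then show ?thesis by blast
      next
        case False
        then obtain y where y: "y \<in> L0" "y \<notin> span (insert x L)" by blast
        have "L0 \<subseteq> span (insert y (span (insert x L)))"
          using T[OF T_base[OF x(1) y(1)] _ _ _ x(2) y(2)] x y L0(2) by blast
        then show ?thesis by blast
      qed
    qed
    then have "dim L0 \<le> dim (L0 \<inter> L) + 2"
      using dim_le_dim_Int_add2[OF finE L0(1,2) L(1)] by blast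
    then show ?thesis using C L0(3) by (simp add: Int_commute)
  qed
qed

end

section \<open>The coordinate space and osculating spaces in a fixed frame\<close>

lemma sum_fun_apply: "(\<Sum>i\<in>A. f i) x = (\<Sum>i\<in>A. f i x)"
  by (induction A rule: infinite_finite_induct) simp_all

abbreviation unit_vec :: "nat \<Rightarrow> nat \<Rightarrow> 'a::field" where
  "unit_vec k \<equiv> (\<lambda>i. if i = k then 1 else 0)"

lemma vecs_Suc: "(vecs (Suc k) :: (nat \<Rightarrow> 'a::field) set) = lspan (insert (unit_vec k) (vecs k))"
proof -
  have s: "lspan (vecs k) = (vecs k :: (nat \<Rightarrow> 'a) set)" by (simp add: subspace_vecs)
  have "v \<in> vecs (Suc k) \<longleftrightarrow> (\<exists>m. v - fscale m (unit_vec k) \<in> vecs k)" for v :: "nat \<Rightarrow> 'a"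
  proof
    assume "v \<in> vecs (Suc k)"
    then have "v - fscale (v k) (unit_vec k) \<in> vecs k"
      by (auto simp: vecs_def fscale_def Suc_le_eq)
    then show "\<exists>m. v - fscale m (unit_vec k) \<in> vecs k" ..
  qed (auto simp: vecs_def fscale_def)
  then show ?thesis by (auto simp: fs.span_breakdown_eq s)
qed

lemma vecs_eq_span: "(vecs N :: (nat \<Rightarrow> 'a::field) set) = lspan (unit_vec ` {..<N})"
proof (induction N)
  case 0
  then show ?case by (auto simp: vecs_def fun_eq_iff)
next
  case (Suc N)
  then show ?case
    by (auto simp: vecs_Suc lessThan_Suc fs.span_breakdown_eq fs.span_span)
qed

lemma dim_vecs: "ldim (vecs N :: (nat \<Rightarrow> 'a::field) set) = N"
proof (induction N)
  case 0
  have "(vecs 0 :: (nat \<Rightarrow> 'a) set) = lspan {}" by (auto simp: vecs_def fun_eq_iff)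
  then show ?case using fs.dim_le_card[of "vecs 0 :: (nat \<Rightarrow> 'a) set" "{}"] by simp
next
  case (Suc N)
  have "unit_vec N \<notin> (vecs N :: (nat \<Rightarrow> 'a) set)" by (simp add: vecs_def)
  then show ?case
    unfolding vecs_Suc
    using fs.dim_span_insert_notin[of "unit_vec ` {..<N}" "vecs N :: (nat \<Rightarrow> 'a) set" "unit_vec N"]
      Suc by (simp add: subspace_vecs flip: vecs_eq_span)
qed

lemma dot_taylor_rnc:
  "coeff (\<Sum>j\<le>d. smult (w j) ([:a, c:] ^ (d - j) * [:b, e:] ^ j)) m
     = dot (Suc d) w (taylor_rnc d a b c e m)"
  by (simp add: dot_def taylor_rnc_def coeff_sum lessThan_Suc_atMost)

lemma taylor_rnc_in_vecs: "taylor_rnc d a b c e i \<in> vecs (Suc d)"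
  by (simp add: vecs_def taylor_rnc_def)

text \<open>One fixed direction (c,e) replaces the family of all directions in \<open>osc\<close>.
  The index counts vectors, so it exceeds the osculation order by one and k = 0 gives the empty
  space.\<close>

definition osc_span :: "nat \<Rightarrow> 'a::field \<Rightarrow> 'a \<Rightarrow> 'a \<Rightarrow> 'a \<Rightarrow> nat \<Rightarrow> (nat \<Rightarrow> 'a) set" where
  "osc_span d a b c e k = lspan (taylor_rnc d a b c e ` {..<k})"

context
  fixes a b c e :: "'a::field"
  assumes ace: "a * e - b * c = 1"
begin

text \<open>With (c',e') = l (a,b) + n (c,e), the arc is (1 + l s) (a,b) + n s (c,e). The vector q_i
  then carries the factor s^i, so only i <= m contributes to the coefficient of s^m.\<close>

lemma taylor_rnc_change_direction:
  "taylor_rnc d a b c' e' m \<in> osc_span d a b c e (Suc m)"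
proof -
  interpret ring_map "\<lambda>x :: 'a. [:x:]"
    by unfold_locales auto
  define l where "l = c' * e - e' * c"
  define n where "n = a * e' - b * c'"
  let ?X = "[:1, l:]" let ?q = "taylor_rnc d a b c e"
  have "a * l + c * n = c' * (a * e - b * c)" "b * l + e * n = e' * (a * e - b * c)"
    unfolding l_def n_def by algebra+
  then have AB: "[:a:] * ?X + [:c:] * [:0, n:] = [:a, c':]" "[:b:] * ?X + [:e:] * [:0, n:] = [:b, e':]"
    by (simp_all add: ace mult.commute)
  have "taylor_rnc d a b c' e' m = (\<Sum>i\<le>d. fscale (coeff (?X ^ (d - i) * [:0, n:] ^ i) m) (?q i))"
  proof
    fix j
    show "taylor_rnc d a b c' e' m j = (\<Sum>i\<le>d. fscale (coeff (?X ^ (d - i) * [:0, n:] ^ i) m) (?q i)) j"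
    proof (cases "j \<le> d")
      case True
      have "[:a, c':] ^ (d - j) * [:b, e':] ^ j = (\<Sum>i\<le>d. smult (?q i j) (?X ^ (d - i) * [:0, n:] ^ i))"
        using taylor_rnc_expansion[OF True, of a ?X c "[:0, n:]" b e] unfolding AB by simp
      then show ?thesis using True
        by (simp add: taylor_rnc_def[of _ _ _ c'] coeff_sum sum_fun_apply fscale_def mult.commute)
    next
      case False
      then show ?thesis by (simp add: taylor_rnc_def sum_fun_apply fscale_def)
    qed
  qed
  also have "\<dots> \<in> osc_span d a b c e (Suc m)"
    unfolding osc_span_def
  proof (rule fs.span_sum)
    fix i
    show "fscale (coeff (?X ^ (d - i) * [:0, n:] ^ i) m) (?q i) \<in> lspan (?q ` {..<Suc m})"
    proof (cases "i \<le> m")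
      case True
      then show ?thesis by (intro fs.span_scale fs.span_base) auto
    next
      case False
      have "[:0, n:] ^ i = monom (n ^ i) i"
        by (metis monom_0 monom_Suc monom_power mult_1 One_nat_def)
      then have "coeff (?X ^ (d - i) * [:0, n:] ^ i) m = 0"
        using False by (simp add: mult.commute[of _ "monom _ _"] coeff_monom_mult)
      then have "fscale (coeff (?X ^ (d - i) * [:0, n:] ^ i) m) (?q i) = 0" by simp
      then show ?thesis by (simp only: fs.span_zero)
    qed
  qed
  finally show ?thesis .
qed

lemma osc_eq_osc_span: "osc d (int k - 1) a b = osc_span d a b c e k"
proof (cases k)
  case 0
  then show ?thesis by (simp add: osc_def osc_span_def)
next
  case (Suc m)
  have "osc d (int k - 1) a b = lspan {taylor_rnc d a b c e i | c e i. i \<le> m}"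
    unfolding osc_def taylor_rnc_def using Suc by simp
  also have "\<dots> = osc_span d a b c e k"
    unfolding osc_span_def
  proof (rule fs.span_eq[THEN iffD2], intro conjI)
    show "taylor_rnc d a b c e ` {..<k} \<subseteq> lspan {taylor_rnc d a b c e i | c e i. i \<le> m}"
      using Suc by (force intro: fs.span_base)
    have "osc_span d a b c e (Suc i) \<subseteq> osc_span d a b c e k" if "i \<le> m" for i
      unfolding osc_span_def using that Suc by (intro fs.span_mono) auto
    then show "{taylor_rnc d a b c e i | c e i. i \<le> m} \<subseteq> lspan (taylor_rnc d a b c e ` {..<k})"
      using taylor_rnc_change_direction[of d] by (fold osc_span_def) blast
  qed
  finally show ?thesis .
qed

text \<open>For X = e - c s and Y = a s - b the expansion reads (1, s) in place of the moving point.
  Comparing coefficients of s inverts the matrix of Taylor vectors.\<close>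

lemma vecs_subset_osc_span: "vecs (Suc d) \<subseteq> osc_span d a b c e (Suc d)"
proof
  fix v :: "nat \<Rightarrow> 'a" assume v: "v \<in> vecs (Suc d)"
  interpret ring_map "\<lambda>x :: 'a. [:x:]"
    by unfold_locales auto
  let ?X = "[:e, - c:]" and ?Y = "[:- b, a:]" and ?q = "taylor_rnc d a b c e"
  have AB: "[:a:] * ?X + [:c:] * ?Y = 1" "[:b:] * ?X + [:e:] * ?Y = [:0, 1:]"
    using ace by (simp_all add: one_pCons algebra_simps)
  define M where "M i m = coeff (?X ^ (d - i) * ?Y ^ i) m" for i m
  have delta: "(\<Sum>i\<le>d. ?q i j * M i m) = (if j = m then 1 else 0)" if j: "j \<le> d" for j m
  proof -
    have "[:0, 1:] ^ j = (\<Sum>i\<le>d. smult (?q i j) (?X ^ (d - i) * ?Y ^ i))"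
      using taylor_rnc_expansion[OF j, of a ?X c ?Y b e] unfolding AB by simp
    then have "coeff ([:0, 1:] ^ j) m = (\<Sum>i\<le>d. ?q i j * M i m)"
      by (simp add: coeff_sum M_def)
    moreover have "[:0, 1 :: 'a:] ^ j = monom 1 j"
      by (simp add: monom_altdef)
    ultimately show ?thesis by simp
  qed
  have "v = (\<Sum>i\<le>d. fscale (\<Sum>m\<le>d. v m * M i m) (?q i))"
  proof
    fix j
    show "v j = (\<Sum>i\<le>d. fscale (\<Sum>m\<le>d. v m * M i m) (?q i)) j"
    proof (cases "j \<le> d")
      case True
      have "(\<Sum>i\<le>d. fscale (\<Sum>m\<le>d. v m * M i m) (?q i)) j
        = (\<Sum>i\<le>d. \<Sum>m\<le>d. v m * (?q i j * M i m))"
        by (simp add: sum_fun_apply fscale_def sum_distrib_right sum_distrib_left ac_simps)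
      also have "\<dots> = (\<Sum>m\<le>d. v m * (\<Sum>i\<le>d. ?q i j * M i m))"
        by (subst sum.swap) (simp add: sum_distrib_left)
      also have "\<dots> = v j" using True by (simp add: delta if_distrib cong: if_cong)
      finally show ?thesis by simp
    next
      case False
      then show ?thesis using v by (simp add: vecs_def taylor_rnc_def sum_fun_apply fscale_def)
    qed
  qed
  also have "\<dots> \<in> osc_span d a b c e (Suc d)"
    unfolding osc_span_def by (intro fs.span_sum fs.span_scale fs.span_base) auto
  finally show "v \<in> osc_span d a b c e (Suc d)" .
qed

text \<open>Each further Taylor vector adds at most one dimension. Since d + 1 of them fill a space
  of dimension d + 1, none of the steps can lose a dimension.\<close>

lemma dim_osc_span_ge:
  assumes "k \<le> Suc d"
  shows "k \<le> ldim (osc_span d a b c e k)"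
proof -
  have sub: "osc_span d a b c e k \<subseteq> lspan (unit_vec ` {..<Suc d})" for k
    unfolding osc_span_def vecs_eq_span[symmetric]
    using taylor_rnc_in_vecs by (intro fs.span_minimal subspace_vecs) blast
  have "ldim (osc_span d a b c e (k + m)) \<le> ldim (osc_span d a b c e k) + m" for m
  proof (induction m)
    case (Suc m)
    have "osc_span d a b c e (Suc (k + m))
        = lspan (insert (taylor_rnc d a b c e (k + m)) (osc_span d a b c e (k + m)))"
      by (auto simp: osc_span_def lessThan_Suc fs.span_breakdown_eq fs.span_span)
    then have "ldim (osc_span d a b c e (Suc (k + m))) \<le> Suc (ldim (osc_span d a b c e (k + m)))"
      using fs.dim_span_insert_le[OF _ _ sub[of "k + m"]] by (simp add: osc_span_def)
    then show ?case using Suc by simp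
  qed simp
  from this[of "Suc d - k"] have "ldim (osc_span d a b c e (Suc d)) \<le> ldim (osc_span d a b c e k) + (Suc d - k)"
    using assms by simp
  moreover have "Suc d \<le> ldim (osc_span d a b c e (Suc d))"
    using fs.dim_subset_le[OF _ vecs_subset_osc_span sub] dim_vecs[of "Suc d"] by (metis finite_imageI finite_lessThan)
  ultimately show ?thesis using assms by linarith
qed

end

section \<open>Determinant forms vanishing to third order along every arc\<close>

definition arcs_cube_dvd :: "nat \<Rightarrow> nat \<Rightarrow> (nat \<Rightarrow> 'a::field) set \<Rightarrow> 'a \<Rightarrow> 'a \<Rightarrow>
    (nat \<Rightarrow> 'a) \<Rightarrow> (nat \<Rightarrow> 'a) \<Rightarrow> (nat \<Rightarrow> 'a) \<Rightarrow> bool" where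
  "arcs_cube_dvd n r L0 a b x y z \<longleftrightarrow> (\<forall>u ya yb. arc_in_I n r L0 a b u ya yb \<longrightarrow>
      fps_X ^ 3 dvd det_cols (\<lambda>k. dot (n + 3) (u k) (const_vec x)) (\<lambda>k. dot (n + 3) (u k) (const_vec y))
        (\<lambda>k. dot (n + 3) (u k) (const_vec z)))"

lemma fps_X_dvd_dot_of_arc:
  assumes "arc_in_I n r L0 a b u ya yb" "v \<in> L0" "k < 3"
  shows "fps_X dvd dot (n + 3) (u k) (const_vec v)"
proof -
  have "(\<Sum>j<n + 3. fps_nth (u k j) 0 * v j) = 0"
    using assms unfolding arc_in_I_def eq_rep_def by blast
  then show ?thesis
    using fps_X_power_dvd_iff[of 1 "dot (n + 3) (u k) (const_vec v)"]
    by (simp add: dot_def const_vec_def fps_sum_nth)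
qed

text \<open>\<open>w\<close> and \<open>m\<close> are chosen before the equation f, so the
  decomposition holds for a whole column at once.\<close>

lemma dot_const_vec_in_span_insert:
  assumes "v \<in> lspan (insert q S)" "lsubspace S"
  shows "\<exists>w\<in>S. \<exists>m. \<forall>N f. dot N f (const_vec v) = dot N f (const_vec w) + m * dot N f (const_vec q)"
proof -
  obtain m where m: "v - fscale m q \<in> S"
    using assms by (auto simp: fs.span_breakdown_eq fs.span_eq_iff[THEN iffD2])
  have "v = (v - fscale m q) + fscale m q" by simp
  then have "dot N f (const_vec v) = dot N f (const_vec (v - fscale m q)) + fps_const m * dot N f (const_vec q)" for N f
    by (metis dot_const_vec_add dot_const_vec_fscale)
  then show ?thesis using m by blast
qed

context
  fixes n r :: nat and L0 :: "(nat \<Rightarrow> 'a::field) set" and a b c e :: 'a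
  assumes ace: "a * e - b * c = 1" and r: "r \<ge> 1" "r \<le> n" and L0: "lsubspace L0"
begin

private abbreviation "q \<equiv> taylor_rnc (n + 2) a b c e"
private abbreviation "L1 \<equiv> lspan (insert (q r) L0)"

lemma taylor_columns_of_arc':
  assumes "arc_in_I n r L0 a b u ya yb"
  shows "\<exists>\<alpha> \<beta>. fps_X dvd \<alpha> \<and> fps_X\<^sup>2 dvd \<beta> \<and>
           (\<forall>k<3. fps_X ^ 3 dvd dot (n + 3) (u k) (const_vec (q (r - 1)))
              - (\<alpha> * dot (n + 3) (u k) (const_vec (q r)) + \<beta> * dot (n + 3) (u k) (const_vec (q (Suc r)))))"
    and "\<And>i. i + 2 \<le> r \<Longrightarrow> \<exists>\<gamma>. fps_X\<^sup>2 dvd \<gamma> \<and> (\<forall>k<3. fps_X ^ 3 dvd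
            dot (n + 3) (u k) (const_vec (q i)) - \<gamma> * dot (n + 3) (u k) (const_vec (q r)))"
proof -
  have van: "\<And>k. k < 3 \<Longrightarrow> vanishes_order (n + 2) (u k) ya yb r"
    and y0: "fps_nth ya 0 = a" "fps_nth yb 0 = b"
    using assms by (auto simp: arc_in_I_def)
  have N: "Suc (n + 2) = n + 3" by simp
  have rn: "r < n + 2" using r by simp
  note * = taylor_columns_of_arc[OF ace van y0 rn r(1), unfolded N]
  show "\<exists>\<alpha> \<beta>. fps_X dvd \<alpha> \<and> fps_X\<^sup>2 dvd \<beta> \<and>
           (\<forall>k<3. fps_X ^ 3 dvd dot (n + 3) (u k) (const_vec (q (r - 1)))
              - (\<alpha> * dot (n + 3) (u k) (const_vec (q r)) + \<beta> * dot (n + 3) (u k) (const_vec (q (Suc r)))))"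
    by (rule *(1))
  show "\<And>i. i + 2 \<le> r \<Longrightarrow> \<exists>\<gamma>. fps_X\<^sup>2 dvd \<gamma> \<and> (\<forall>k<3. fps_X ^ 3 dvd
            dot (n + 3) (u k) (const_vec (q i)) - \<gamma> * dot (n + 3) (u k) (const_vec (q r)))"
    by (rule *(2))
qed

lemma arcs_cube_dvd_low:
  assumes "i + 2 \<le> r" "y \<in> L1"
  shows "arcs_cube_dvd n r L0 a b (q i) y z"
  unfolding arcs_cube_dvd_def
proof (intro allI impI)
  fix u ya yb assume arc: "arc_in_I n r L0 a b u ya yb"
  obtain w m where w: "w \<in> L0" and y: "\<And>f. dot (n + 3) f (const_vec y)
      = dot (n + 3) f (const_vec w) + m * dot (n + 3) f (const_vec (q r))"
    using dot_const_vec_in_span_insert[OF assms(2) L0] by blast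
  obtain \<gamma> where g: "fps_X\<^sup>2 dvd \<gamma>" "\<And>k. k < 3 \<Longrightarrow> fps_X ^ 3 dvd
      dot (n + 3) (u k) (const_vec (q i)) - \<gamma> * dot (n + 3) (u k) (const_vec (q r))"
    using taylor_columns_of_arc'(2)[OF arc assms(1)] by blast
  show "fps_X ^ 3 dvd det_cols (\<lambda>k. dot (n + 3) (u k) (const_vec (q i)))
      (\<lambda>k. dot (n + 3) (u k) (const_vec y)) (\<lambda>k. dot (n + 3) (u k) (const_vec z))"
    unfolding y by (rule cube_dvd_det_cols_low[OF g(2,1) fps_X_dvd_dot_of_arc[OF arc w]])
qed

lemma arcs_cube_dvd_middle:
  assumes "y \<in> L1" "z \<in> L1"
  shows "arcs_cube_dvd n r L0 a b (q (r - 1)) y z"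
  unfolding arcs_cube_dvd_def
proof (intro allI impI)
  fix u ya yb assume arc: "arc_in_I n r L0 a b u ya yb"
  obtain w m where w: "w \<in> L0" and y: "\<And>f. dot (n + 3) f (const_vec y)
      = dot (n + 3) f (const_vec w) + m * dot (n + 3) f (const_vec (q r))"
    using dot_const_vec_in_span_insert[OF assms(1) L0] by blast
  obtain w' m' where w': "w' \<in> L0" and z: "\<And>f. dot (n + 3) f (const_vec z)
      = dot (n + 3) f (const_vec w') + m' * dot (n + 3) f (const_vec (q r))"
    using dot_const_vec_in_span_insert[OF assms(2) L0] by blast
  obtain \<alpha> \<beta> where ab: "fps_X dvd \<alpha>" "fps_X\<^sup>2 dvd \<beta>" "\<And>k. k < 3 \<Longrightarrow>
      fps_X ^ 3 dvd dot (n + 3) (u k) (const_vec (q (r - 1)))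
        - (\<alpha> * dot (n + 3) (u k) (const_vec (q r)) + \<beta> * dot (n + 3) (u k) (const_vec (q (Suc r))))"
    using taylor_columns_of_arc'(1)[OF arc] by blast
  show "fps_X ^ 3 dvd det_cols (\<lambda>k. dot (n + 3) (u k) (const_vec (q (r - 1))))
      (\<lambda>k. dot (n + 3) (u k) (const_vec y)) (\<lambda>k. dot (n + 3) (u k) (const_vec z))"
    unfolding y z by (rule cube_dvd_det_cols_middle[OF ab(3,1,2)
          fps_X_dvd_dot_of_arc[OF arc w] fps_X_dvd_dot_of_arc[OF arc w']])
qed

lemma arcs_cube_dvd_top:
  assumes "z \<in> lspan (insert (q (Suc r)) L1)"
  shows "arcs_cube_dvd n r L0 a b (q (r - 1)) (q r) z"
  unfolding arcs_cube_dvd_def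
proof (intro allI impI)
  fix u ya yb assume arc: "arc_in_I n r L0 a b u ya yb"
  obtain v m' where v: "v \<in> L1" and z: "\<And>f. dot (n + 3) f (const_vec z)
      = dot (n + 3) f (const_vec v) + m' * dot (n + 3) f (const_vec (q (Suc r)))"
    using dot_const_vec_in_span_insert[OF assms fs.subspace_span] by blast
  obtain w m where w: "w \<in> L0" and v: "\<And>f. dot (n + 3) f (const_vec v)
      = dot (n + 3) f (const_vec w) + m * dot (n + 3) f (const_vec (q r))"
    using dot_const_vec_in_span_insert[OF v L0] by blast
  obtain \<alpha> \<beta> where ab: "fps_X dvd \<alpha>" "fps_X\<^sup>2 dvd \<beta>" "\<And>k. k < 3 \<Longrightarrow>
      fps_X ^ 3 dvd dot (n + 3) (u k) (const_vec (q (r - 1)))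
        - (\<alpha> * dot (n + 3) (u k) (const_vec (q r)) + \<beta> * dot (n + 3) (u k) (const_vec (q (Suc r))))"
    using taylor_columns_of_arc'(1)[OF arc] by blast
  show "fps_X ^ 3 dvd det_cols (\<lambda>k. dot (n + 3) (u k) (const_vec (q (r - 1))))
      (\<lambda>k. dot (n + 3) (u k) (const_vec (q r))) (\<lambda>k. dot (n + 3) (u k) (const_vec z))"
    unfolding z v by (rule cube_dvd_det_cols_top[OF ab(3,1,2) fps_X_dvd_dot_of_arc[OF arc w]])
qed

lemma arcs_cube_dvd_top':
  assumes "q (Suc r) \<in> L1"
  shows "arcs_cube_dvd n r L0 a b (q (r - 1)) (q r) z"
  unfolding arcs_cube_dvd_def
proof (intro allI impI)
  fix u ya yb assume arc: "arc_in_I n r L0 a b u ya yb"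
  obtain w m where w: "w \<in> L0" and y: "\<And>f. dot (n + 3) f (const_vec (q (Suc r)))
      = dot (n + 3) f (const_vec w) + m * dot (n + 3) f (const_vec (q r))"
    using dot_const_vec_in_span_insert[OF assms L0] by blast
  obtain \<alpha> \<beta> where ab: "fps_X dvd \<alpha>" "fps_X\<^sup>2 dvd \<beta>" "\<And>k. k < 3 \<Longrightarrow>
      fps_X ^ 3 dvd dot (n + 3) (u k) (const_vec (q (r - 1)))
        - (\<alpha> * dot (n + 3) (u k) (const_vec (q r)) + \<beta> * dot (n + 3) (u k) (const_vec (q (Suc r))))"
    using taylor_columns_of_arc'(1)[OF arc] by blast
  show "fps_X ^ 3 dvd det_cols (\<lambda>k. dot (n + 3) (u k) (const_vec (q (r - 1))))
      (\<lambda>k. dot (n + 3) (u k) (const_vec (q r))) (\<lambda>k. dot (n + 3) (u k) (const_vec z))"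
    by (rule cube_dvd_det_cols_top'[OF ab(3,1,2) fps_X_dvd_dot_of_arc[OF arc w] y])
qed

end

lemma arcs_cube_dvd_base:
  assumes "x \<in> L0" "y \<in> L0" "z \<in> L0"
  shows "arcs_cube_dvd n r L0 a b x y z"
  unfolding arcs_cube_dvd_def
proof (intro allI impI)
  fix u ya yb assume arc: "arc_in_I n r L0 a b u ya yb"
  have "fps_X * fps_X * fps_X dvd det_cols (\<lambda>k. dot (n + 3) (u k) (const_vec x))
      (\<lambda>k. dot (n + 3) (u k) (const_vec y)) (\<lambda>k. dot (n + 3) (u k) (const_vec z))"
    by (intro det_cols_dvd fps_X_dvd_dot_of_arc[OF arc] assms)
  then show "fps_X ^ 3 dvd det_cols (\<lambda>k. dot (n + 3) (u k) (const_vec x))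
      (\<lambda>k. dot (n + 3) (u k) (const_vec y)) (\<lambda>k. dot (n + 3) (u k) (const_vec z))"
    by (simp add: power3_eq_cube)
qed

section \<open>Planes on the second osculating space\<close>

lemma arcs_cube_dvd_imp_dependent:
  assumes L: "L \<in> grass n" "pl_in n L (osc2_Z n r L0 a b)"
    and cube: "arcs_cube_dvd n r L0 a b x y z"
    and v: "x \<in> vecs (n + 3)" "y \<in> vecs (n + 3)" "z \<in> vecs (n + 3)"
    and notin: "x \<notin> L" "y \<notin> lspan (insert x L)"
  shows "z \<in> lspan (insert y (lspan (insert x L)))"
proof -
  obtain u where u: "eq_rep (n + 3) L u" "pluecker (n + 3) u \<in> osc2_Z n r L0 a b"
    using L(2) unfolding pl_in_def by blast
  have "pl_form (n + 3) x y z (pluecker (n + 3) u) = 0"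
    by (rule pl_form_osc2_Z_eq_0[OF u(2)]) (use cube in \<open>auto simp: arcs_cube_dvd_def\<close>)
  then show ?thesis
    using eq_rep_det_eq_0_imp_dependent[OF u(1) _ v _ notin] L(1)
    by (simp add: det_cols_dot grass_def)
qed

text \<open>Without arcs every determinant form would vanish vacuously, so any three vectors would
  be dependent modulo \<open>L\<close>, which has codimension 3. The arc is wanted because it
  supplies three equations cutting out Lambda_0.\<close>

lemma exists_arc:
  assumes L: "L \<in> grass n" "pl_in n L (osc2_Z n r L0 a b)"
  shows "\<exists>u ya yb. arc_in_I n r L0 a b u ya yb"
proof (rule ccontr)
  assume "\<nexists>u ya yb. arc_in_I n r L0 a b u ya yb"
  then have cube: "arcs_cube_dvd n r L0 a b x y z" for x y z
    by (simp add: arcs_cube_dvd_def)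
  have L': "lsubspace L" "L \<subseteq> vecs (n + 3)" "ldim L = n" using L(1) by (auto simp: grass_def)
  have amb: "finite (unit_vec ` {..<n + 3} :: (nat \<Rightarrow> 'a) set)"
    "lspan (unit_vec ` {..<n + 3}) = (vecs (n + 3) :: (nat \<Rightarrow> 'a) set)"
    by (simp_all add: vecs_eq_span)
  have dimV: "ldim (vecs (n + 3) :: (nat \<Rightarrow> 'a) set) = n + 3" by (rule dim_vecs)
  have step: "\<exists>x\<in>vecs (n + 3). x \<notin> S \<and> lspan (insert x S) \<subseteq> vecs (n + 3) \<and> ldim (lspan (insert x S)) = Suc (ldim S)"
    if S: "lsubspace S" "S \<subseteq> vecs (n + 3)" "ldim S < n + 3" for S :: "(nat \<Rightarrow> 'a) set"
  proof -
    have "S \<noteq> vecs (n + 3)" using S(3) dimV by auto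
    then obtain x where x: "x \<in> vecs (n + 3)" "x \<notin> S" using S(2) by blast
    moreover have "lspan (insert x S) \<subseteq> vecs (n + 3)"
      using x(1) S(2) by (intro fs.span_minimal subspace_vecs) auto
    moreover have "ldim (lspan (insert x S)) = Suc (ldim S)"
      using fs.dim_span_insert_notin[OF amb(1) S(1) _ x(2)] S(2) unfolding amb(2) by blast
    ultimately show ?thesis by blast
  qed
  obtain x where x: "x \<in> vecs (n + 3)" "x \<notin> L" "lspan (insert x L) \<subseteq> vecs (n + 3)"
      "ldim (lspan (insert x L)) = Suc n"
    using step[OF L'(1,2)] L'(3) by auto
  obtain y where y: "y \<in> vecs (n + 3)" "y \<notin> lspan (insert x L)"
      "lspan (insert y (lspan (insert x L))) \<subseteq> vecs (n + 3)"
      "ldim (lspan (insert y (lspan (insert x L)))) = Suc (Suc n)"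
    using step[OF fs.subspace_span x(3)] unfolding x(4) by auto
  obtain z where "z \<in> vecs (n + 3)" "z \<notin> lspan (insert y (lspan (insert x L)))"
    using step[OF fs.subspace_span y(3)] unfolding y(4) by auto
  then show False
    using arcs_cube_dvd_imp_dependent[OF L cube x(1) y(1) _ x(2) y(2)] by blast
qed

theorem theorem4p1:
  fixes n r :: nat and L0 :: "(nat \<Rightarrow> 'a::field_char_0) set" and a b :: 'a
  assumes alg_closed: "\<And>p :: 'a poly. degree p > 0 \<Longrightarrow> \<exists>x. poly p x = 0"
    and n_ge: "n \<ge> 1" and r_ge: "r \<ge> 1"
    and L0: "L0 \<in> grass n"
    and y: "(a, b) \<noteq> (0, 0)"
    and zero_dim: "int_zero_dim (n + 3) L0"
    and mult_r: "int_len_ge (n + 3) L0 a b r" "\<not> int_len_ge (n + 3) L0 a b (r + 1)"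
  shows "{L \<in> grass n. pl_in n L (osc2_Z n r L0 a b)}
           \<subseteq> setA n r L0 a b \<union> setB n r L0 a b \<union> setC n r L0 a b"
proof
  fix L assume "L \<in> {L \<in> grass n. pl_in n L (osc2_Z n r L0 a b)}"
  then have L: "L \<in> grass n" "pl_in n L (osc2_Z n r L0 a b)" by auto
  \<comment> \<open>The point y is completed to a frame of determinant 1.\<close>
  obtain c e where ace: "a * e - b * c = 1"
  proof (cases "a = 0")
    case True
    then show ?thesis using y that[of 0 "- 1 / b"] by simp
  next
    case False
    then show ?thesis using that[of "1 / a" 0] by simp
  qed
  define q where "q = taylor_rnc (n + 2) a b c e"
  define Q where "Q = osc_span (n + 2) a b c e"
  have Q_span: "Q k = lspan (q ` {..<k})" for k by (simp add: Q_def q_def osc_span_def)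
  have osc: "osc (n + 2) (int k - 1) a b = Q k" for k
    unfolding Q_def by (rule osc_eq_osc_span[OF ace])
  have L': "lsubspace L" "L \<subseteq> vecs (n + 3)" "ldim L = n" using L(1) by (auto simp: grass_def)
  have L0': "lsubspace L0" "L0 \<subseteq> vecs (n + 3)" "ldim L0 = n" using L0 by (auto simp: grass_def)
  have qV: "q i \<in> vecs (n + 3)" for i
    using taylor_rnc_in_vecs[of "n + 2"] by (simp add: q_def numeral_3_eq_3)
  have amb: "finite (unit_vec ` {..<n + 3} :: (nat \<Rightarrow> 'a) set)"
    "lspan (unit_vec ` {..<n + 3}) = (vecs (n + 3) :: (nat \<Rightarrow> 'a) set)"
    by (simp_all add: vecs_eq_span)
  have dimV: "ldim (vecs (n + 3) :: (nat \<Rightarrow> 'a) set) = n + 3" by (rule dim_vecs)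
  have dimQ: "k \<le> ldim (Q k)" if "k \<le> n + 3" for k
    unfolding Q_def by (rule dim_osc_span_ge[OF ace]) (use that in simp)
  obtain u ya yb where arc: "arc_in_I n r L0 a b u ya yb"
    using exists_arc[OF L] by blast
  define u0 where "u0 = (\<lambda>i j. fps_nth (u i j) 0)"
  have rep: "eq_rep (n + 3) L0 u0" using arc by (simp add: arc_in_I_def u0_def)
  \<comment> \<open>The arc at t = 0 presents \<open>L0\<close> as the zero set of three of its
    equations, so \<open>L0\<close> is recovered from \<open>eqs\<close>.\<close>
  have in_L0: "z \<in> L0" if "z \<in> vecs (n + 3)" "\<And>w. w \<in> eqs (n + 3) L0 \<Longrightarrow> dot (n + 3) w z = 0" for z
  proof -
    have "u0 i \<in> eqs (n + 3) L0" if "i < 3" for i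
      using rep that unfolding eq_rep_def eqs_def vecs_def by blast
    then have "\<forall>i<3. dot (n + 3) (u0 i) z = 0" using that(2) by blast
    then show ?thesis using rep that(1) unfolding eq_rep_def dot_def by blast
  qed
  have vo: "vanishes_order (n + 2) w a b k \<longleftrightarrow>
      (\<forall>c e. \<forall>m<k. dot (n + 3) w (taylor_rnc (n + 2) a b c e m) = 0)" for w k
    unfolding vanishes_order_def dot_taylor_rnc by (simp add: numeral_3_eq_3)
  have qL0: "q i \<in> L0" if "i < r" for i
  proof (rule in_L0[OF qV])
    fix w assume "w \<in> eqs (n + 3) L0"
    then show "dot (n + 3) w (q i) = 0"
      using mult_r(1) that vo[of w r] unfolding int_len_ge_def q_def by simp
  qed
  \<comment> \<open>This is where the multiplicity is exactly r: with q_r also in \<open>L0\<close>,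
    all Taylor vectors of order at most r in every direction would lie there, giving contact of
    order r + 1.\<close>
  have qrL0: "q r \<notin> L0"
  proof
    assume "q r \<in> L0"
    then have QL0: "Q (Suc r) \<subseteq> L0"
      unfolding Q_span using qL0 L0'(1) by (intro fs.span_minimal) (auto simp: less_Suc_eq)
    have "dot (n + 3) w (taylor_rnc (n + 2) a b c' e' m) = 0"
      if w: "w \<in> eqs (n + 3) L0" and m: "m < r + 1" for w c' e' m
    proof -
      have "Q (Suc m) \<subseteq> Q (Suc r)"
        unfolding Q_span using m by (intro fs.span_mono) auto
      then have "taylor_rnc (n + 2) a b c' e' m \<in> L0"
        using taylor_rnc_change_direction[OF ace, of "n + 2" c' e' m] QL0 unfolding Q_def by blast
      then show ?thesis using w by (simp add: eqs_def dot_def)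
    qed
    then have "int_len_ge (n + 3) L0 a b (r + 1)"
      using vo unfolding int_len_ge_def by simp
    then show False using mult_r(2) by blast
  qed
  have Q_sub: "Q k \<subseteq> L0" if "k \<le> r" for k
    unfolding Q_span using that qL0 L0'(1) by (intro fs.span_minimal) auto
  \<comment> \<open>The minimum with n + 3 is needed because the dimension bound \<open>dimQ\<close>
    holds only up to the ambient dimension.\<close>
  have rn: "r \<le> n"
  proof -
    have "min r (n + 3) \<le> ldim (Q (min r (n + 3)))" by (rule dimQ) simp
    also have "\<dots> \<le> ldim L0"
      by (rule fs.dim_subset_le[OF amb(1)]) (use Q_sub L0'(2) amb(2) in auto)
    finally show ?thesis using L0'(3) by simp
  qed
  let ?L1 = "lspan (insert (q r) L0)"
  let ?L2 = "lspan (insert (q (Suc r)) ?L1)"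
  note arcs = ace r_ge rn L0'(1)
  have trichotomy: "L \<subseteq> ?L2 \<and> r \<le> Suc (ldim (L \<inter> Q r)) \<or>
    Q (r - 1) \<subseteq> L \<and> r \<le> ldim (L \<inter> Q (Suc r)) \<and> n \<le> Suc (ldim (L \<inter> ?L1)) \<or>
    Q r \<subseteq> L \<and> n \<le> ldim (L \<inter> L0) + 2"
    unfolding Q_span
  proof (rule fs.osculating_trichotomy[OF amb(1), unfolded amb(2), where T = "arcs_cube_dvd n r L0 a b"])
    show "r \<le> ldim (lspan (q ` {..<r}))" "Suc r \<le> ldim (lspan (q ` {..<Suc r}))"
      using dimQ rn unfolding Q_span by simp_all
    show "lspan (q ` {..<r}) \<subseteq> L0" using Q_sub unfolding Q_span by simp
    show "z \<in> lspan (insert y (lspan (insert x L)))"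
      if "arcs_cube_dvd n r L0 a b x y z" "x \<in> vecs (n + 3)" "y \<in> vecs (n + 3)" "z \<in> vecs (n + 3)"
        "x \<notin> L" "y \<notin> lspan (insert x L)" for x y z
      using that by (rule arcs_cube_dvd_imp_dependent[OF L])
    show "arcs_cube_dvd n r L0 a b (q i) y z" if "i + 2 \<le> r" "y \<in> ?L1" for i y z
      using that arcs_cube_dvd_low[OF arcs, folded q_def] by simp
    show "arcs_cube_dvd n r L0 a b (q (r - 1)) y z" if "y \<in> ?L1" "z \<in> ?L1" for y z
      using that arcs_cube_dvd_middle[OF arcs, folded q_def] by simp
    show "arcs_cube_dvd n r L0 a b (q (r - 1)) (q r) z" if "z \<in> ?L2" for z
      using that arcs_cube_dvd_top[OF arcs, folded q_def] by simp
    show "arcs_cube_dvd n r L0 a b (q (r - 1)) (q r) z" if "q (Suc r) \<in> ?L1" for z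
      using that arcs_cube_dvd_top'[OF arcs, folded q_def] by simp
    show "arcs_cube_dvd n r L0 a b x y z" if "x \<in> L0" "y \<in> L0" "z \<in> L0" for x y z
      using that by (rule arcs_cube_dvd_base)
  qed (use L' L0' qV r_ge qrL0 dimV in simp_all)
  \<comment> \<open>Translation from the osculation orders in \<open>setA\<close>,
    \<open>setB\<close>, \<open>setC\<close> to the numbers of spanning vectors in
    \<open>Q\<close>.\<close>
  have shift: "int (r + 2) - 1 = int r + 1" "int (Suc r) - 1 = int r" "int (r - 1) - 1 = int r - 2"
    using r_ge by auto
  note osc' = osc[of "r + 2", unfolded shift] osc[of "Suc r", unfolded shift]
    osc[of "r - 1", unfolded shift] osc[of r]
  have L1_sub: "?L1 \<subseteq> lspan (L0 \<union> Q k)" if "r < k" for k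
  proof (intro fs.span_minimal fs.subspace_span insert_subsetI)
    show "q r \<in> lspan (L0 \<union> Q k)"
      unfolding Q_span using that by (blast intro: fs.span_base)
  qed (auto intro: fs.span_base)
  from trichotomy consider
      (A) "L \<subseteq> ?L2" "r \<le> Suc (ldim (L \<inter> Q r))"
    | (B) "Q (r - 1) \<subseteq> L" "r \<le> ldim (L \<inter> Q (Suc r))" "n \<le> Suc (ldim (L \<inter> ?L1))"
    | (C) "Q r \<subseteq> L" "n \<le> ldim (L \<inter> L0) + 2" by blast
  then show "L \<in> setA n r L0 a b \<union> setB n r L0 a b \<union> setC n r L0 a b"
  proof cases
    case A
    have "?L2 \<subseteq> lspan (L0 \<union> Q (r + 2))"
    proof (rule fs.span_minimal[OF insert_subsetI fs.subspace_span])
      have "q (Suc r) \<in> Q (r + 2)" unfolding Q_span by (rule fs.span_base) simp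
      then show "q (Suc r) \<in> lspan (L0 \<union> Q (r + 2))" by (rule fs.span_base[OF UnI2])
      show "?L1 \<subseteq> lspan (L0 \<union> Q (r + 2))" by (rule L1_sub) simp
    qed
    then have "L \<in> setA n r L0 a b"
      using A L(1) unfolding setA_def osc' pdim_def by simp
    then show ?thesis by simp
  next
    case B
    have "ldim (L \<inter> ?L1) \<le> ldim (L \<inter> lspan (L0 \<union> Q (Suc r)))"
      by (rule fs.dim_subset_le[OF amb(1)]) (use L1_sub[of "Suc r"] L'(2) amb(2) in auto)
    then have "L \<in> setB n r L0 a b"
      using B L(1) unfolding setB_def osc' pdim_def by simp
    then show ?thesis by simp
  next
    case C
    then have "L \<in> setC n r L0 a b"
      using L(1) unfolding setC_def osc' pdim_def by simp
    then show ?thesis by simp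
  qed
qed

end
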